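(* Biclique-Free Vertex Deletion (BFVD) can be solved in time $\mathcal{O}^*(2^{\mathcal{O}(dk^2)})$, where $d$ is the degeneracy of the input graph $G$ and $k$ is the solution-size bound.
   Context: BFVD: given an undirected graph $G$ and integers $i,j,k$ with $i\le j$, decide whether there is a set $V'\subseteq V(G)$ with $|V'|\le k$ such that $G-V'$ contains no complete bipartite graph $K_{i,j}$ as a (not necessarily induced) subgraph. The degeneracy of $G$ is the smallest $d$ such that every subgraph of $G$ has a vertex of degree at most $d$. The notation $\mathcal{O}^*(f)$ hides factors polynomial in the input size.
   Formalization: The exponent uses max(1,k) in place of k: for k ≥ 1 the bound is as stated, while for k = 0 (deciding whether G contains K_{i,j}, where the literal bound would give a polynomial algorithm for an NP-hard problem) the bound proved is O*(2^{O(d)}). *)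

theory Defs
  imports "Graph_Theory.Graph_Theory" "HOL-Computational_Algebra.Polynomial"
begin

section \<open>Biclique-free vertex deletion and degeneracy\<close>

text \<open>
  An undirected graph is a finite, loop-free, symmetric digraph without parallel arcs (locale
  \<^locale>\<open>graph\<close>); an undirected edge corresponds to a pair of opposite arcs, so that the degree of
  a vertex is its out-degree.
\<close>

definition contains_biclique :: "nat \<Rightarrow> nat \<Rightarrow> ('a,'b) pre_digraph \<Rightarrow> bool" where
  "contains_biclique i j G \<longleftrightarrow> (\<exists>H. subgraph H G \<and> K\<^bsub>i,j\<^esub> H)"

definition bfvd :: "nat \<Rightarrow> nat \<Rightarrow> nat \<Rightarrow> ('a,'b) pre_digraph \<Rightarrow> bool" where
  "bfvd i j k G \<longleftrightarrow>
     (\<exists>S. S \<subseteq> verts G \<and> card S \<le> k \<and> \<not> contains_biclique i j (G \<restriction> (verts G - S)))"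

text \<open>
  For \<open>k = 0\<close> the problem is to decide whether the graph contains a biclique, which is NP-hard, so
  a running time \<open>2 ^ O(d * k\<^sup>2)\<close> times a polynomial can only be meant for positive \<open>k\<close>. The bound
  uses \<open>max 1 k\<close> in place of \<open>k\<close>; this changes nothing for positive \<open>k\<close> and gives
  \<open>2 ^ O(d)\<close> for \<open>k = 0\<close>.
\<close>

text \<open>
  The condition \<^term>\<open>graph H\<close> makes \<^term>\<open>H\<close> an undirected subgraph (arcs occur in
  opposite pairs).
\<close>

definition degeneracy :: "('a,'b) pre_digraph \<Rightarrow> nat" where
  "degeneracy G = (LEAST d. \<forall>H. subgraph H G \<and> graph H \<and> verts H \<noteq> {} \<longrightarrow>
     (\<exists>v \<in> verts H. out_degree H v \<le> d))"

section \<open>Model of computation\<close>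

text \<open>
  Programs are systems of first-order, call-by-value recursive functions on binary trees (the
  language F of N. D. Jones, Computability and Complexity, MIT Press 1997, here with several
  arguments per function and local definitions). Data can be inspected only by testing for
  \<open>Leaf\<close> and by taking the components of a \<open>Node\<close>, and every evaluation step
  costs one unit. With trees represented by shared pointers each step of a fixed program takes
  constant time, so running times agree with those of Turing machines and of random access
  machines (with logarithmic cost) up to a polynomial, which is the precision of \<open>O\<^sup>*\<close> bounds.

  \<open>Var n\<close> is a de Bruijn index into the environment, \<open>Let\<close> pushes a value on it,
  and a function body is evaluated in the environment formed by its arguments.
\<close>

datatype val = Leaf | Node val val

datatype expr =
    Var nat
  | LeafE
  | NodeE expr expr
  | FstE expr
  | SndE expr
  | IfE expr expr expr
  | LetE expr expr
  | Call nat "expr list"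

type_synonym program = "expr list"

fun fst_val :: "val \<Rightarrow> val" where
  "fst_val Leaf = Leaf"
| "fst_val (Node x y) = x"

fun snd_val :: "val \<Rightarrow> val" where
  "snd_val Leaf = Leaf"
| "snd_val (Node x y) = y"

text \<open>
  \<open>evaluates P env e v t\<close>: in the environment \<open>env\<close>, the expression \<open>e\<close> evaluates
  to \<open>v\<close> in \<open>t\<close> steps.
\<close>

inductive evaluates :: "program \<Rightarrow> val list \<Rightarrow> expr \<Rightarrow> val \<Rightarrow> nat \<Rightarrow> bool"
  and evaluates_list :: "program \<Rightarrow> val list \<Rightarrow> expr list \<Rightarrow> val list \<Rightarrow> nat \<Rightarrow> bool"
  for P :: program
where
  Var: "n < length env \<Longrightarrow> evaluates P env (Var n) (env ! n) 1"
| LeafE: "evaluates P env LeafE Leaf 1"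
| NodeE: "evaluates P env e1 v1 t1 \<Longrightarrow> evaluates P env e2 v2 t2 \<Longrightarrow>
    evaluates P env (NodeE e1 e2) (Node v1 v2) (t1 + t2 + 1)"
| FstE: "evaluates P env e v t \<Longrightarrow> evaluates P env (FstE e) (fst_val v) (t + 1)"
| SndE: "evaluates P env e v t \<Longrightarrow> evaluates P env (SndE e) (snd_val v) (t + 1)"
| IfTrue: "evaluates P env b w s \<Longrightarrow> w \<noteq> Leaf \<Longrightarrow> evaluates P env e1 v t \<Longrightarrow>
    evaluates P env (IfE b e1 e2) v (s + t + 1)"
| IfFalse: "evaluates P env b Leaf s \<Longrightarrow> evaluates P env e2 v t \<Longrightarrow>
    evaluates P env (IfE b e1 e2) v (s + t + 1)"
| LetE: "evaluates P env e1 w s \<Longrightarrow> evaluates P (w # env) e2 v t \<Longrightarrow>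
    evaluates P env (LetE e1 e2) v (s + t + 1)"
| Call: "f < length P \<Longrightarrow> evaluates_list P env es vs s \<Longrightarrow> evaluates P vs (P ! f) v t \<Longrightarrow>
    evaluates P env (Call f es) v (s + t + 1)"
| Nil: "evaluates_list P env [] [] 0"
| Cons: "evaluates P env e v s \<Longrightarrow> evaluates_list P env es vs t \<Longrightarrow>
    evaluates_list P env (e # es) (v # vs) (s + t)"

inductive_cases evaluates_VarE: "evaluates P env (Var n) v t"
inductive_cases evaluates_LeafE: "evaluates P env LeafE v t"
inductive_cases evaluates_NodeE: "evaluates P env (NodeE e1 e2) v t"
inductive_cases evaluates_FstE: "evaluates P env (FstE e) v t"
inductive_cases evaluates_SndE: "evaluates P env (SndE e) v t"
inductive_cases evaluates_IfE: "evaluates P env (IfE b e1 e2) v t"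
inductive_cases evaluates_LetE: "evaluates P env (LetE e1 e2) v t"
inductive_cases evaluates_CallE: "evaluates P env (Call f es) v t"
inductive_cases evaluates_list_NilE: "evaluates_list P env [] vs t"
inductive_cases evaluates_list_ConsE: "evaluates_list P env (e # es) vs t"

lemma evaluates_deterministic:
  shows "evaluates P env e v t \<Longrightarrow> (\<And>v' t'. evaluates P env e v' t' \<Longrightarrow> v' = v \<and> t' = t)"
    and "evaluates_list P env es vs u \<Longrightarrow> (\<And>vs' u'. evaluates_list P env es vs' u' \<Longrightarrow> vs' = vs \<and> u' = u)"
proof (induction rule: evaluates_evaluates_list.inducts)
  case Var
  from Var.prems show ?case by (rule evaluates_VarE) auto
next
  case LeafE
  from LeafE.prems show ?case by (rule evaluates_LeafE) auto
next
  case NodeE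
  from NodeE.prems show ?case by (rule evaluates_NodeE) (auto dest!: NodeE.IH(2,4))
next
  case FstE
  from FstE.prems show ?case by (rule evaluates_FstE) (auto dest!: FstE.IH(2))
next
  case SndE
  from SndE.prems show ?case by (rule evaluates_SndE) (auto dest!: SndE.IH(2))
next
  case IfTrue
  from IfTrue.prems show ?case by (rule evaluates_IfE) (auto dest!: IfTrue.IH(2,4) simp: IfTrue.hyps)
next
  case IfFalse
  from IfFalse.prems show ?case by (rule evaluates_IfE) (auto dest!: IfFalse.IH(2,4))
next
  case LetE
  from LetE.prems show ?case by (rule evaluates_LetE) (auto dest!: LetE.IH(2,4))
next
  case Call
  from Call.prems show ?case by (rule evaluates_CallE) (auto dest!: Call.IH(3,5))
next
  case Nil
  from Nil.prems show ?case by (rule evaluates_list_NilE) auto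
next
  case Cons
  from Cons.prems show ?case by (rule evaluates_list_ConsE) (auto dest!: Cons.IH(2,4))
qed

text \<open>Function 0 is the entry point.\<close>

definition runs :: "program \<Rightarrow> val \<Rightarrow> val \<Rightarrow> nat \<Rightarrow> bool" where
  "runs P x v t \<longleftrightarrow> evaluates P [x] (Call 0 [Var 0]) v t"

lemma runs_deterministic: "runs P x v t \<Longrightarrow> runs P x v' t' \<Longrightarrow> v' = v \<and> t' = t"
  unfolding runs_def using evaluates_deterministic(1) by blast

section \<open>Encoding of instances\<close>

text \<open>
  Graphs are given by their adjacency matrix and numbers in binary, least significant bit first.
  The size of an instance is the number of \<open>Node\<close>s (\<^const>\<open>size\<close>) of its encoding.
\<close>

fun enc_bool :: "bool \<Rightarrow> val" where
  "enc_bool False = Leaf"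
| "enc_bool True = Node Leaf Leaf"

fun enc_list :: "('a \<Rightarrow> val) \<Rightarrow> 'a list \<Rightarrow> val" where
  "enc_list f [] = Leaf"
| "enc_list f (x # xs) = Node (f x) (enc_list f xs)"

fun bits :: "nat \<Rightarrow> bool list" where
  "bits n = (if n = 0 then [] else odd n # bits (n div 2))"

declare bits.simps [simp del]

definition enc_nat :: "nat \<Rightarrow> val" where
  "enc_nat n = enc_list enc_bool (bits n)"

definition adj_matrix :: "nat pair_pre_digraph \<Rightarrow> bool list list" where
  "adj_matrix G = (let vs = sorted_list_of_set (pverts G)
     in map (\<lambda>u. map (\<lambda>v. (u, v) \<in> parcs G) vs) vs)"

definition enc_instance :: "nat pair_pre_digraph \<Rightarrow> nat \<Rightarrow> nat \<Rightarrow> nat \<Rightarrow> val" where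
  "enc_instance G i j k =
     Node (enc_list (enc_list enc_bool) (adj_matrix G)) (Node (enc_nat i) (Node (enc_nat j) (enc_nat k)))"

end

theory Submission
  imports Defs "HOL-Library.Sublist"
begin

text \<open>
  Order the vertices so that every vertex has at most \<open>d\<close> later neighbours. If \<open>A, B\<close> are the
  sides of a biclique, then the first vertex of \<open>A \<union> B\<close> has the whole opposite side among its later
  neighbours, so at most \<open>n 2\<^sup>d + 1\<close> candidate sides \<open>X\<close> have to be inspected.

  Suppose that \<open>X\<close> is a side of a forbidden biclique. A solution \<open>S\<close> deletes a vertex of \<open>X\<close>, or one
  of the at most \<open>d\<^sup>2\<close> later neighbours of \<open>X\<close>, or only common neighbours of \<open>X\<close> that precede
  all of \<open>X\<close>; in the last case \<open>X\<close> is contained in the later neighbours of a single vertex of \<open>S\<close>.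
  The algorithm branches on the first two possibilities and otherwise adds \<open>X\<close> to a set \<open>U\<close> of
  undeletable vertices, where \<open>|U| \<le> d k\<close> may be assumed since \<open>U\<close> is covered by the later
  neighbours of \<open>S\<close>. As soon as all remaining candidates lie inside \<open>U\<close>, only the trace
  \<open>N(b) \<inter> U\<close> of a deleted vertex \<open>b\<close> matters, so it suffices to branch on one representative of each
  of the at most \<open>2\<^sup>d\<^sup>k\<close> traces. Depth \<open>k\<close> gives \<open>2 ^ O(d k\<^sup>2)\<close> leaves.
\<close>

section \<open>The branching algorithm\<close>

text \<open>The algorithm never computes the degeneracy. It works with \<open>d\<close>, the largest
  number of later neighbours in a greedy minimum-degree order, and this is at most the degeneracy.
  Adding a set to \<open>U\<close> consumes no deletion, so \<open>k\<close> alone bounds neither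
  depth nor size of the search tree. A second budget \<open>L = d * k\<close> bounds the length of
  \<open>U\<close>; it also makes the number of traces \<open>2 ^ (d * k)\<close>, and
  \<open>k\<close> levels of such branching produce the exponent \<open>d * k^2\<close>. The
  delicate point is why \<open>L\<close> suffices. The sets collected in \<open>U\<close> are
  covered by later neighbourhoods of the whole solution, including vertices deleted meanwhile, which
  are no longer in the current vertex list. Completeness therefore fixes sets \<open>N s\<close>
  that contain the later neighbourhoods throughout and carries along the set \<open>S0\<close> of
  vertices of the solution already deleted. Exchanging solution vertices happens only when all
  violated candidates lie inside \<open>U\<close>; deletions preserve that condition,
  \<open>U\<close> stops growing, and the cover is no longer consulted.\<close>

definition common :: "(nat \<Rightarrow> nat \<Rightarrow> bool) \<Rightarrow> nat list \<Rightarrow> nat list \<Rightarrow> nat list" where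
  "common E X V = filter (\<lambda>v. \<forall>x\<in>set X. E v x) V"

text \<open>The list is read as an elimination order, so \<open>vs\<close> is what comes after
  \<open>v\<close>. The base case keeps the empty side a candidate when no vertex is left, as the
  biclique with \<open>i = j = 0\<close> requires.\<close>

fun cands :: "(nat \<Rightarrow> nat \<Rightarrow> bool) \<Rightarrow> nat list \<Rightarrow> nat list list" where
  "cands E [] = [[]]"
| "cands E (v # vs) = subseqs (filter (E v) vs) @ cands E vs"

text \<open>A candidate does not reveal which side of the biclique it is, so both sizes are tried.
  The opposite side is only counted, because any subset of the common neighbours of the right size
  completes the biclique.\<close>

definition viol :: "(nat \<Rightarrow> nat \<Rightarrow> bool) \<Rightarrow> nat \<Rightarrow> nat \<Rightarrow> nat list \<Rightarrow> nat list \<Rightarrow> bool" where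
  "viol E i j V X \<longleftrightarrow> length X = i \<and> j \<le> length (common E X V) \<or>
                     length X = j \<and> i \<le> length (common E X V)"

fun out :: "(nat \<Rightarrow> nat \<Rightarrow> bool) \<Rightarrow> nat list \<Rightarrow> nat \<Rightarrow> nat list" where
  "out E [] x = []"
| "out E (v # vs) x = (if x = v then filter (E x) vs else out E vs x)"

definition same_type :: "(nat \<Rightarrow> nat \<Rightarrow> bool) \<Rightarrow> nat list \<Rightarrow> nat \<Rightarrow> nat \<Rightarrow> bool" where
  "same_type E U b c \<longleftrightarrow> (\<forall>u\<in>set U. E b u = E c u)"

fun reps :: "(nat \<Rightarrow> nat \<Rightarrow> bool) \<Rightarrow> nat list \<Rightarrow> nat list \<Rightarrow> nat list" where
  "reps E U [] = []"
| "reps E U (b # bs) = (if \<exists>c\<in>set bs. same_type E U b c then reps E U bs else b # reps E U bs)"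

fun argmin :: "(nat \<Rightarrow> nat \<Rightarrow> bool) \<Rightarrow> nat list \<Rightarrow> nat \<Rightarrow> nat list \<Rightarrow> nat" where
  "argmin E V b [] = b"
| "argmin E V b (v # vs) =
    (if length (filter (E b) V) \<le> length (filter (E v) V) then argmin E V b vs else argmin E V v vs)"

lemma argmin_in: "argmin E V b vs \<in> insert b (set vs)"
proof (induction vs arbitrary: b)
  case (Cons w vs)
  show ?case using Cons.IH[of b] Cons.IH[of w] by auto
qed simp

lemma argmin_le:
  "v \<in> insert b (set vs) \<Longrightarrow>
    length (filter (E (argmin E V b vs)) V) \<le> length (filter (E v) V)"
proof (induction vs arbitrary: b v)
  case (Cons w vs)
  let ?d = "\<lambda>v. length (filter (E v) V)"
  define b' where "b' = (if ?d b \<le> ?d w then b else w)"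
  have eq: "argmin E V b (w # vs) = argmin E V b' vs" by (simp add: b'_def)
  have b': "?d (argmin E V b' vs) \<le> ?d b'" by (rule Cons.IH) simp
  show ?case
  proof (cases "v \<in> set vs")
    case True
    then show ?thesis unfolding eq by (intro Cons.IH) simp
  next
    case False
    then have "?d b' \<le> ?d v" using Cons.prems by (auto simp: b'_def)
    with b' show ?thesis unfolding eq by linarith
  qed
qed simp

text \<open>Greedy degeneracy ordering: a vertex of minimum degree among the remaining ones is taken
  out next.\<close>

function elim_order :: "(nat \<Rightarrow> nat \<Rightarrow> bool) \<Rightarrow> nat list \<Rightarrow> nat list" where
  "elim_order E [] = []"
| "elim_order E (v # vs) = (let b = argmin E (v # vs) v vs in b # elim_order E (filter (\<lambda>x. x \<noteq> b) (v # vs)))"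
  by pat_completeness auto
termination
proof (relation "measure (\<lambda>(E, V). length V)")
  fix E v vs b
  assume "b = argmin E (v # vs) v vs"
  then have "b \<in> set (v # vs)" using argmin_in[of E "v # vs" v vs] by simp
  then have "length (filter (\<lambda>x. x \<noteq> b) (v # vs)) < length (v # vs)"
    by (intro length_filter_less[of b]) auto
  then show "((E, filter (\<lambda>x. x \<noteq> b) (v # vs)), E, v # vs) \<in> measure (\<lambda>(E, V). length V)"
    by simp
qed simp

text \<open>Only the length of this list matters: it is the largest number of later neighbours.\<close>

fun max_out :: "(nat \<Rightarrow> nat \<Rightarrow> bool) \<Rightarrow> nat list \<Rightarrow> nat list" where
  "max_out E [] = []"
| "max_out E (v # vs) =
    (if length (filter (E v) vs) \<le> length (max_out E vs) then max_out E vs else filter (E v) vs)"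

lemma length_max_out: "length (max_out E V) \<le> length V"
  by (induction V) (auto intro: le_SucI)

lemma length_max_out_Cons [simp]:
  "length (max_out E (v # vs)) = max (length (filter (E v) vs)) (length (max_out E vs))"
  by simp

lemma length_cands: "length (cands E V) \<le> (length V + 1) * 2 ^ length (max_out E V)"
proof (induction V)
  case (Cons v vs)
  let ?a = "length (filter (E v) vs)" and ?m = "length (max_out E vs)"
  have "length (cands E vs) \<le> (length vs + 1) * 2 ^ max ?a ?m"
    using Cons.IH by (rule order_trans) (intro mult_le_mono power_increasing, auto)
  moreover have "(2::nat) ^ ?a \<le> 2 ^ max ?a ?m"
    by (intro power_increasing) auto
  ultimately have "2 ^ ?a + length (cands E vs) \<le> 2 ^ max ?a ?m + (length vs + 1) * 2 ^ max ?a ?m"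
    by (rule add_mono[rotated])
  then show ?case
    by (simp add: length_subseqs del: max_out.simps)
qed simp

lemma cands_props:
  assumes "X \<in> set (cands E V)"
  shows "set X \<subseteq> set V" "length X \<le> length (max_out E V)" "distinct V \<Longrightarrow> distinct X"
proof -
  have "set X \<subseteq> set V \<and> length X \<le> length (max_out E V) \<and> (distinct V \<longrightarrow> distinct X)"
    using assms
  proof (induction V)
    case (Cons v vs)
    then consider "X \<in> set (subseqs (filter (E v) vs))" | "X \<in> set (cands E vs)" by auto
    then show ?case
    proof cases
      case 1
      then have "set X \<subseteq> set (filter (E v) vs)" "length X \<le> length (filter (E v) vs)"
        "distinct vs \<longrightarrow> distinct X"
        using subseqs_powset[of "filter (E v) vs"] subseqs_distinctD[OF 1] 1
        by (blast, simp add: list_emb_length, simp)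
      then show ?thesis by auto
    next
      case 2
      then show ?thesis using Cons.IH by auto
    qed
  qed simp
  then show "set X \<subseteq> set V" "length X \<le> length (max_out E V)" "distinct V \<Longrightarrow> distinct X"
    by auto
qed

lemma length_union_less: "\<not> set X \<subseteq> set U \<Longrightarrow> length U < length (List.union X U)"
proof (induction X arbitrary: U)
  case (Cons x X)
  have *: "length U \<le> length (List.union X U)" for U :: "'a list"
  proof (induction X arbitrary: U)
    case (Cons y Y)
    show ?case using Cons[of U] Cons[of "y # U"] by (auto simp: List.union_def List.insert_def)
  qed (simp add: List.union_def)
  show ?case
  proof (cases "x \<in> set U")
    case True
    then show ?thesis using Cons by (auto simp: List.union_def List.insert_def)
  next
    case False
    then show ?thesis using *[of "x # U"] by (auto simp: List.union_def List.insert_def)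
  qed
qed simp

text \<open>The termination measure for the call that keeps \<open>k\<close> and enlarges
  \<open>U\<close>. The test against \<open>L\<close> matters: beyond \<open>L\<close> the truncated
  difference would be stuck at 0.\<close>

lemma union_budget:
  assumes "find (\<lambda>X. P X \<and> \<not> set X \<subseteq> set U) cs = Some X" "length (List.union X U) \<le> L"
  shows "L - length (List.union X U) < L - length U"
proof -
  have "\<not> set X \<subseteq> set U" using assms(1) by (auto simp: find_Some_iff)
  from length_union_less[OF this] assms(2) show ?thesis by linarith
qed

text \<open>Conditionals replace connectives so that the guards \<open>k = 0\<close> and
  \<open>length (List.union X U) \<le> L\<close> become hypotheses of the termination goals.
  \<open>L\<close> keeps its initial value while \<open>k\<close> decreases.\<close>

function solve :: "(nat \<Rightarrow> nat \<Rightarrow> bool) \<Rightarrow> nat \<Rightarrow> nat \<Rightarrow> nat \<Rightarrow> nat list \<Rightarrow> nat list \<Rightarrow> nat \<Rightarrow> bool" where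
  "solve E i j L V U k =
    (case find (\<lambda>X. viol E i j V X \<and> \<not> set X \<subseteq> set U) (cands E V) of
      Some X \<Rightarrow>
        if (if k = 0 then False
            else list_ex (\<lambda>c. solve E i j L (filter (\<lambda>y. y \<noteq> c) V) U (k - 1)) (X @ concat (map (out E V) X)))
        then True
        else if length (List.union X U) \<le> L then solve E i j L V (List.union X U) k else False
    | None \<Rightarrow>
        if find (viol E i j V) (cands E V) = None then True
        else if k = 0 then False
        else list_ex (\<lambda>c. solve E i j L (filter (\<lambda>y. y \<noteq> c) V) U (k - 1)) (reps E U V))"
  by pat_completeness auto
termination
proof (relation "measures [\<lambda>(E, i, j, L, V, U, k). k, \<lambda>(E, i, j, L, V, U, k). L - length U]",
    goal_cases)
  case (4 E i j L V U k X)
  show ?case using union_budget[OF 4(1,3)] by simp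
qed simp_all
declare solve.simps [simp del]

lemma set_reps: "set (reps E U V) \<subseteq> set V"
  by (induction V) auto

lemma distinct_types_reps: "distinct (map (\<lambda>b. {u \<in> set U. E b u}) (reps E U V))"
proof (induction V)
  case (Cons b bs)
  have "{u \<in> set U. E b u} \<noteq> {u \<in> set U. E c u}"
    if "\<not> (\<exists>c\<in>set bs. same_type E U b c)" "c \<in> set (reps E U bs)" for c
    using that set_reps[of E U bs] unfolding same_type_def by blast
  with Cons show ?case by auto
qed simp

text \<open>Distinct representatives have distinct traces on \<open>U\<close>, so they inject into
  the subsets of \<open>U\<close>.\<close>

lemma length_reps: "length (reps E U V) \<le> 2 ^ length U"
proof -
  let ?ts = "map (\<lambda>b. {u \<in> set U. E b u}) (reps E U V)"
  have "length (reps E U V) = card (set ?ts)"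
    using distinct_card[OF distinct_types_reps] by simp
  also have "\<dots> \<le> card (Pow (set U))"
    by (intro card_mono) auto
  also have "\<dots> \<le> 2 ^ length U" by (simp add: card_Pow card_length)
  finally show ?thesis .
qed

lemma set_out: "set (out E V x) \<subseteq> set V"
  by (induction V) auto

lemma length_out: "length (out E V x) \<le> length (max_out E V)"
  by (induction V) auto

text \<open>Deletions preserve the relative order and only shrink later neighbourhoods. Hence one
  order, computed at the start, serves the whole recursion.\<close>

lemma max_out_filter: "length (max_out E (filter P V)) \<le> length (max_out E V)"
proof (induction V)
  case (Cons v vs)
  have "length (filter (E v) (filter P vs)) \<le> length (filter (E v) vs)"
    using length_filter_le[of P "filter (E v) vs"] by (simp add: conj_commute)
  then show ?case using Cons by auto
qed simp

section \<open>Correctness of the algorithm\<close>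

text \<open>Disjointness of the sides is implicit: for a loop-free \<open>E\<close>, a common
  element would be adjacent to itself.\<close>

definition biclique :: "(nat \<Rightarrow> nat \<Rightarrow> bool) \<Rightarrow> nat \<Rightarrow> nat \<Rightarrow> nat set \<Rightarrow> bool" where
  "biclique E i j W \<longleftrightarrow> (\<exists>A B. A \<subseteq> W \<and> B \<subseteq> W \<and> card A = i \<and> card B = j \<and> (\<forall>a\<in>A. \<forall>b\<in>B. E a b))"

definition simple_on :: "(nat \<Rightarrow> nat \<Rightarrow> bool) \<Rightarrow> nat set \<Rightarrow> bool" where
  "simple_on E W \<longleftrightarrow> (\<forall>u\<in>W. \<not> E u u) \<and> (\<forall>u\<in>W. \<forall>v\<in>W. E u v \<longrightarrow> E v u)"

lemma simple_on_subset: "simple_on E W \<Longrightarrow> W' \<subseteq> W \<Longrightarrow> simple_on E W'"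
  unfolding simple_on_def by blast

lemma cands_complete:
  assumes "simple_on E (set V)" "A \<subseteq> set V" "B \<subseteq> set V" "\<forall>a\<in>A. \<forall>b\<in>B. E a b"
  shows "\<exists>X\<in>set (cands E V). set X = A \<or> set X = B"
  using assms
proof (induction V)
  case Nil
  then show ?case by auto
next
  case (Cons v vs)
  have nbr: "\<exists>X\<in>set (subseqs (filter (E v) vs)). set X = C"
    if "C \<subseteq> set (v # vs)" "\<forall>c\<in>C. E v c" for C
  proof -
    \<comment> \<open>If \<open>v\<close> were in \<open>C\<close>, it would carry a loop.\<close>
    have "v \<notin> C" using that Cons.prems(1) unfolding simple_on_def by auto
    then have "C \<subseteq> set (filter (E v) vs)" using that by auto
    from subset_subseqs[OF this] show ?thesis by auto
  qed
  consider "v \<in> A" | "v \<in> B" | "v \<notin> A" "v \<notin> B" by blast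
  then show ?case
  proof cases
    case 1
    then have "\<forall>b\<in>B. E v b" using Cons.prems(4) by blast
    from nbr[OF Cons.prems(3) this] show ?thesis by auto
  next
    case 2
    then have "\<forall>a\<in>A. E v a" using Cons.prems unfolding simple_on_def by blast
    from nbr[OF Cons.prems(2) this] show ?thesis by auto
  next
    case 3
    have "simple_on E (set vs)" using Cons.prems(1) by (rule simple_on_subset) auto
    moreover have "A \<subseteq> set vs" "B \<subseteq> set vs" using 3 Cons.prems(2,3) by auto
    ultimately show ?thesis using Cons.IH Cons.prems(4) by auto
  qed
qed

lemma viol_imp_biclique:
  assumes E: "simple_on E (set V)" and V: "distinct V" and X: "distinct X" "set X \<subseteq> set V"
    and v: "viol E i j V X"
  shows "biclique E i j (set V)"
proof -
  have c: "card (set (common E X V)) = length (common E X V)"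
    using V unfolding common_def by (intro distinct_card) simp
  have sub: "set (common E X V) \<subseteq> set V" unfolding common_def by auto
  have adj: "E a x \<and> E x a" if "a \<in> set (common E X V)" "x \<in> set X" for a x
    using that E X(2) unfolding common_def simple_on_def by auto
  from v consider "length X = i" "j \<le> card (set (common E X V))"
    | "length X = j" "i \<le> card (set (common E X V))"
    unfolding viol_def c by blast
  then show ?thesis
  proof cases
    case 1
    then obtain B where "B \<subseteq> set (common E X V)" "card B = j" by (meson obtain_subset_with_card_n)
    then show ?thesis unfolding biclique_def using sub adj X 1
      by (intro exI[of _ "set X"] exI[of _ B]) (auto simp: distinct_card)
  next
    case 2
    then obtain A where "A \<subseteq> set (common E X V)" "card A = i" by (meson obtain_subset_with_card_n)
    then show ?thesis unfolding biclique_def using sub adj X 2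
      by (intro exI[of _ A] exI[of _ "set X"]) (auto simp: distinct_card)
  qed
qed

text \<open>Converse of \<open>viol_imp_biclique\<close>: inspecting candidates decides whether the
  current graph is biclique-free.\<close>

lemma biclique_imp_viol:
  assumes E: "simple_on E (set V)" and V: "distinct V" and b: "biclique E i j (set V)"
  shows "\<exists>X\<in>set (cands E V). viol E i j V X"
proof -
  from b obtain A B where AB: "A \<subseteq> set V" "B \<subseteq> set V" "card A = i" "card B = j"
    "\<forall>a\<in>A. \<forall>b\<in>B. E a b" unfolding biclique_def by blast
  from cands_complete[OF E AB(1,2,5)] obtain X where X: "X \<in> set (cands E V)" "set X = A \<or> set X = B"
    by blast
  have len: "length X = card (set X)" using cands_props(3)[OF X(1) V] by (simp add: distinct_card)
  have c: "card (set (common E X V)) = length (common E X V)"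
    using V unfolding common_def by (intro distinct_card) simp
  from X(2) have "viol E i j V X"
  proof
    assume "set X = A"
    moreover have "B \<subseteq> set (common E X V)"
      using AB E calculation unfolding common_def simple_on_def set_filter by blast
    then have "card B \<le> card (set (common E X V))" by (intro card_mono) auto
    ultimately show ?thesis unfolding viol_def using len AB c by simp
  next
    assume "set X = B"
    moreover have "A \<subseteq> set (common E X V)"
      using AB calculation unfolding common_def by auto
    then have "card A \<le> card (set (common E X V))" by (intro card_mono) auto
    ultimately show ?thesis unfolding viol_def using len AB c by simp
  qed
  with X(1) show ?thesis by blast
qed

text \<open>With \<open>viol_filter\<close>, this shows that a violated candidate after a deletion
  was one before it, so "all violated candidates lie inside \<open>U\<close>" is inherited by the
  recursive calls.\<close>

lemma cands_filter: "set (cands E (filter P V)) \<subseteq> set (cands E V)"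
proof (induction V)
  case (Cons v vs)
  have "filter (E v) (filter P vs) = filter P (filter (E v) vs)"
    by (simp add: conj_commute)
  moreover have "subseq X (filter (E v) vs)" if "subseq X (filter P (filter (E v) vs))" for X
    using that subseq_filter_left by (rule subseq_order.order_trans)
  ultimately have "set (subseqs (filter (E v) (filter P vs))) \<subseteq> set (subseqs (filter (E v) vs))"
    by (auto simp del: filter_filter)
  with Cons show ?case by auto
qed simp

lemma viol_filter:
  assumes "viol E i j (filter P V) X" shows "viol E i j V X"
proof -
  have "length (common E X (filter P V)) \<le> length (common E X V)"
    using length_filter_le[of P "common E X V"] unfolding common_def by (simp add: conj_commute)
  then show ?thesis using assms unfolding viol_def by linarith
qed

lemma out_filter: "set (out E (filter P V) x) \<subseteq> set (out E V x)"
proof (induction V)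
  case (Cons v vs)
  have "x \<notin> set W \<Longrightarrow> out E W x = []" for W
    by (induction W) auto
  with Cons show ?case by auto
qed simp

text \<open>Of two adjacent vertices, the one that comes first in \<open>V\<close> has the other
  among its later neighbours.\<close>

lemma out_or_out:
  "s \<in> set V \<Longrightarrow> x \<in> set V \<Longrightarrow> s \<noteq> x \<Longrightarrow> E s x \<Longrightarrow> E x s \<Longrightarrow>
    s \<in> set (out E V x) \<or> x \<in> set (out E V s)"
  by (induction V) auto

lemma reps_complete: "b \<in> set V \<Longrightarrow> \<exists>c\<in>set (reps E U V). same_type E U b c"
proof (induction V arbitrary: b)
  case (Cons v vs)
  have refl: "same_type E U v v" by (simp add: same_type_def)
  have trans: "same_type E U a b \<Longrightarrow> same_type E U b c \<Longrightarrow> same_type E U a c" for a b c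
    by (simp add: same_type_def)
  show ?case
  proof (cases "b \<in> set vs")
    case True
    then show ?thesis using Cons.IH by auto
  next
    case False
    then have b: "b = v" using Cons.prems by simp
    show ?thesis
    proof (cases "\<exists>c\<in>set vs. same_type E U v c")
      case True
      \<comment> \<open>\<open>v\<close> is dropped in favour of a later vertex of its type, which
        may itself have been dropped; transitivity leads to the one that was kept.\<close>
      then obtain c where c: "c \<in> set vs" "same_type E U v c" by blast
      have "\<exists>c\<in>set (reps E U vs). same_type E U v c"
        using Cons.IH[OF c(1)] trans[OF c(2)] by blast
      then show ?thesis using True b by simp
    qed (use b refl in auto)
  qed
qed simp

text \<open>The vertices deleted along a successful branch form \<open>S\<close>; enlarging
  \<open>U\<close> leaves the graph unchanged.\<close>

lemma solve_sound:
  "solve E i j L V U k \<Longrightarrow> simple_on E (set V) \<Longrightarrow> distinct V \<Longrightarrow>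
    \<exists>S\<subseteq>set V. card S \<le> k \<and> \<not> biclique E i j (set V - S)"
proof (induction E i j L V U k rule: solve.induct)
  case (1 E i j L V U k)
  \<comment> \<open>Undoes one deletion. If \<open>c\<close> does not occur in \<open>V\<close>,
    nothing was deleted and the smaller solution is already good enough.\<close>
  have del: "\<exists>S\<subseteq>set V. card S \<le> k \<and> \<not> biclique E i j (set V - S)"
    if "k \<noteq> 0" "\<exists>S\<subseteq>set (filter (\<lambda>y. y \<noteq> c) V). card S \<le> k - 1 \<and>
      \<not> biclique E i j (set (filter (\<lambda>y. y \<noteq> c) V) - S)" for c
  proof -
    from that(2) obtain S where S: "S \<subseteq> set V - {c}" "card S \<le> k - 1"
      "\<not> biclique E i j (set V - {c} - S)" by (auto simp: set_diff_eq)
    show ?thesis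
    proof (cases "c \<in> set V")
      case True
      have "set V - insert c S = set V - {c} - S" by blast
      moreover have "card (insert c S) \<le> k"
        using S that(1) card_insert_le_m1[of k S c] by simp
      ultimately show ?thesis using S True by (intro exI[of _ "insert c S"]) auto
    next
      case False
      then show ?thesis using S by (intro exI[of _ S]) (auto simp: Diff_insert0)
    qed
  qed
  have sub: "simple_on E (set (filter (\<lambda>y. y \<noteq> c) V))" for c
    using 1(5) by (rule simple_on_subset) auto
  show ?case
  proof (cases "find (\<lambda>X. viol E i j V X \<and> \<not> set X \<subseteq> set U) (cands E V)")
    case None
    show ?thesis
    proof (cases "find (viol E i j V) (cands E V) = None")
      case True
      then have "\<not> biclique E i j (set V)"
        using biclique_imp_viol[OF 1(5,6)] by (auto simp: find_None_iff)
      then show ?thesis by (intro exI[of _ "{}"]) auto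
    next
      case False
      then have k: "k \<noteq> 0" and "list_ex (\<lambda>c. solve E i j L (filter (\<lambda>y. y \<noteq> c) V) U (k - 1)) (reps E U V)"
        using 1(4) None by (subst (asm) solve.simps; simp split: if_splits)+
      then obtain c where c: "c \<in> set (reps E U V)" "solve E i j L (filter (\<lambda>y. y \<noteq> c) V) U (k - 1)"
        by (auto simp: list_ex_iff)
      show ?thesis
        by (rule del[OF k 1(1)[OF None False k c sub]]) (use 1(6) in simp)
    qed
  next
    case (Some X)
    show ?thesis
    proof (cases "k \<noteq> 0 \<and> list_ex (\<lambda>c. solve E i j L (filter (\<lambda>y. y \<noteq> c) V) U (k - 1))
        (X @ concat (map (out E V) X))")
      case True
      then obtain c where k: "k \<noteq> 0" and c: "c \<in> set (X @ concat (map (out E V) X))"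
        "solve E i j L (filter (\<lambda>y. y \<noteq> c) V) U (k - 1)"
        unfolding list_ex_iff by blast
      show ?thesis
        by (rule del[OF k 1(2)[OF Some k c sub]]) (use 1(6) in simp)
    next
      case False
      then have n: "\<not> (if k = 0 then False else list_ex (\<lambda>c. solve E i j L (filter (\<lambda>y. y \<noteq> c) V) U (k - 1))
        (X @ concat (map (out E V) X)))" by auto
      with 1(4) Some have "length (List.union X U) \<le> L \<and> solve E i j L V (List.union X U) k"
        by (subst (asm) solve.simps) (simp split: if_splits)
      with 1(3)[OF Some n] 1(5,6) show ?thesis by blast
    qed
  qed
qed

text \<open>\<open>S\<close> is a solution of the current graph that avoids \<open>U\<close>;
  \<open>S0\<close> collects solution vertices deleted so far, and \<open>k0\<close> is the initial
  number of deletions. The last hypothesis is a disjunction of two phases: either \<open>U\<close>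
  is covered by at most \<open>k0\<close> of the sets \<open>N s\<close>, or all violated candidates
  lie inside \<open>U\<close>. The first is what keeps a growing \<open>U\<close> within
  \<open>L\<close>, the second is what the exchange of a vertex for its representative relies
  on.\<close>

lemma solve_complete:
  assumes N: "\<And>s. finite (N s)" "\<And>s. card (N s) \<le> d" and L: "d * k0 \<le> L"
  shows "simple_on E (set V) \<Longrightarrow> distinct V \<Longrightarrow> distinct U \<Longrightarrow> (\<And>s. set (out E V s) \<subseteq> N s) \<Longrightarrow>
    S \<subseteq> set V \<Longrightarrow> card S \<le> k \<Longrightarrow> S \<inter> set U = {} \<Longrightarrow> \<not> biclique E i j (set V - S) \<Longrightarrow>
    (\<forall>X\<in>set (cands E V). viol E i j V X \<longrightarrow> set X \<subseteq> set U) \<or>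
    (\<exists>S0. finite S0 \<and> card S0 + k \<le> k0 \<and> set U \<subseteq> (\<Union>s\<in>S \<union> S0. N s)) \<Longrightarrow>
    solve E i j L V U k"
  using L
proof (induction E i j L V U k arbitrary: S rule: solve.induct)
  case (1 E i j L V U k)
  note E = 1(4) and V = 1(5) and U = 1(6) and out = 1(7) and S = 1(8-11) and inv = 1(12) and L = 1(13)
  have finS: "finite S" using S(1) by (rule finite_subset) simp
  let ?del = "\<lambda>c. filter (\<lambda>y. y \<noteq> c) V"
  have E': "simple_on E (set (?del c))" for c
    using E by (rule simple_on_subset) auto
  have V': "distinct (?del c)" for c using V by simp
  have out': "set (out E (?del c) s) \<subseteq> N s" for c s
    using out_filter out by (rule order_trans)
  have rest: "set V - T = set (filter (\<lambda>v. v \<notin> T) V)" for T by auto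
  have ET: "simple_on E (set (filter (\<lambda>v. v \<notin> T) V))" for T
    using E by (rule simple_on_subset) auto
  show ?case
  proof (cases "find (\<lambda>X. viol E i j V X \<and> \<not> set X \<subseteq> set U) (cands E V)")
    case None
    then have allU: "\<forall>X\<in>set (cands E V). viol E i j V X \<longrightarrow> set X \<subseteq> set U"
      by (auto simp: find_None_iff)
    show ?thesis
    proof (cases "find (viol E i j V) (cands E V) = None")
      case True
      then show ?thesis using None by (subst solve.simps) simp
    next
      case False
      then obtain X where X: "X \<in> set (cands E V)" "viol E i j V X"
        by (auto simp: find_None_iff simp del: not_None_eq)
      have "biclique E i j (set V)"
        using viol_imp_biclique[OF E V] cands_props[OF X(1)] V X(2) by blast
      with S(4) have "S \<noteq> {}" by auto
      then obtain b where b: "b \<in> S" by blast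
      have k: "k \<noteq> 0" using card_gt_0_iff[of S] b finS S(2) by auto
      obtain c where c: "c \<in> set (reps E U V)" "same_type E U b c"
        using reps_complete b S(1) by blast
      \<comment> \<open>The representative \<open>c\<close>, which the algorithm does try, replaces
        \<open>b\<close>. If \<open>c\<close> is in \<open>S\<close> already, \<open>S\<close> stays
        as it is, since the swap would merely lose \<open>b\<close>.\<close>
      define S' where "S' = (if c \<in> S then S else insert c (S - {b}))"
      have cV: "c \<in> set V" using c(1) set_reps by blast
      have cS': "c \<in> S'" by (simp add: S'_def)
      have S'V: "S' \<subseteq> set V" using S(1) cV by (auto simp: S'_def)
      have "card (insert c (S - {b})) \<le> Suc (card (S - {b}))"
        using finS by (simp add: card_insert_if del: card_Diff_insert)
      then have cardS': "card S' \<le> k"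
        using S(2) card_Suc_Diff1[OF finS b] by (simp add: S'_def)
      \<comment> \<open>The representative \<open>c\<close> may belong to \<open>U\<close>; after
        its deletion only vertices of \<open>S\<close> remain, and these avoid
        \<open>U\<close>.\<close>
      have subS: "S' - {c} \<subseteq> S" by (auto simp: S'_def)
      \<comment> \<open>Exchange argument: all violations lie inside \<open>U\<close>, and \<open>b\<close> and \<open>c\<close> have the same
        neighbours there.\<close>
      have S'sol: "\<not> biclique E i j (set V - S')"
      proof
        assume "biclique E i j (set V - S')"
        then obtain Y where Y: "Y \<in> set (cands E (filter (\<lambda>v. v \<notin> S') V))"
          "viol E i j (filter (\<lambda>v. v \<notin> S') V) Y"
          using biclique_imp_viol[OF ET, of S'] V unfolding rest by auto
        have YV: "Y \<in> set (cands E V)" using Y(1) cands_filter by blast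
        have YU: "set Y \<subseteq> set U" using allU YV viol_filter[OF Y(2)] by blast
        have YS: "set Y \<subseteq> set (filter (\<lambda>v. v \<notin> S) V)"
          using YU S(3) cands_props(1)[OF YV] by auto
        have same: "(\<forall>y\<in>set Y. E b y) \<longleftrightarrow> (\<forall>y\<in>set Y. E c y)"
          using c(2) YU unfolding same_type_def by blast
        let ?C = "\<lambda>T. {v \<in> set V - T. \<forall>y\<in>set Y. E v y}"
        have len: "length (common E Y (filter (\<lambda>v. v \<notin> T) V)) = card (?C T)" for T
        proof -
          have "set (common E Y (filter (\<lambda>v. v \<notin> T) V)) = ?C T" by (auto simp: common_def)
          moreover have "distinct (common E Y (filter (\<lambda>v. v \<notin> T) V))" using V by (simp add: common_def)
          ultimately show ?thesis by (metis distinct_card)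
        qed
        \<comment> \<open>The swap gives back \<open>b\<close> and takes away \<open>c\<close>.
          Since \<open>b\<close> is adjacent to all of \<open>Y\<close> only if \<open>c\<close> is,
          the number of surviving common neighbours does not increase.\<close>
        have "card (?C S') \<le> card (?C S)"
        proof (cases "c \<in> S \<or> \<not> (\<forall>y\<in>set Y. E b y)")
          case True
          then have "?C S' \<subseteq> ?C S" by (auto simp: S'_def)
          then show ?thesis by (intro card_mono) auto
        next
          case False
          then have cC: "c \<in> ?C S" using same cV by auto
          have "?C S' \<subseteq> insert b (?C S - {c})" using False by (auto simp: S'_def)
          then have "card (?C S') \<le> card (insert b (?C S - {c}))" by (intro card_mono) auto
          also have "\<dots> \<le> Suc (card (?C S - {c}))" by (rule card_insert_le_m1) auto
          also have "\<dots> = card (?C S)" using cC by (intro card_Suc_Diff1) auto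
          finally show ?thesis .
        qed
        then have "viol E i j (filter (\<lambda>v. v \<notin> S) V) Y"
          using Y(2) unfolding viol_def len by linarith
        then have "biclique E i j (set V - S)"
          using viol_imp_biclique[OF ET] cands_props(3)[OF YV V] YS V unfolding rest by auto
        with S(4) show False by contradiction
      qed
      have "solve E i j L (?del c) U (k - 1)"
      proof (rule 1(1)[OF None False k c(1) E' V' U out', of "S' - {c}"])
        show "S' - {c} \<subseteq> set (?del c)" using S'V by auto
        show "card (S' - {c}) \<le> k - 1"
          using cardS' cS' S'V finite_subset[OF S'V] by (simp add: card_Diff_singleton)
        show "(S' - {c}) \<inter> set U = {}" using subS S(3) by blast
        have "set (?del c) - (S' - {c}) = set V - S'" using cS' by auto
        then show "\<not> biclique E i j (set (?del c) - (S' - {c}))" using S'sol by simp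
        show "(\<forall>X\<in>set (cands E (?del c)). viol E i j (?del c) X \<longrightarrow> set X \<subseteq> set U) \<or>
          (\<exists>S0. finite S0 \<and> card S0 + (k - 1) \<le> k0 \<and> set U \<subseteq> (\<Union>s\<in>S' - {c} \<union> S0. N s))"
          using allU subsetD[OF cands_filter] viol_filter by (intro disjI1 ballI impI) metis
      qed (rule L)
      then show ?thesis using None False k c(1)
        by (subst solve.simps) (auto simp: list_ex_iff)
    qed
  next
    case (Some X)
    then have X: "X \<in> set (cands E V)" "viol E i j V X" "\<not> set X \<subseteq> set U"
      by (auto simp: find_Some_iff)
    then obtain S0 where S0: "finite S0" "card S0 + k \<le> k0" "set U \<subseteq> (\<Union>s\<in>S \<union> S0. N s)"
      using inv by blast
    let ?C = "X @ concat (map (out E V) X)"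
    show ?thesis
    proof (cases "S \<inter> set ?C = {}")
      case False
      then obtain c where c: "c \<in> S" "c \<in> set ?C" by blast
      have k: "k \<noteq> 0" using card_gt_0_iff[of S] c finS S(2) by auto
      have "solve E i j L (?del c) U (k - 1)"
      proof (rule 1(2)[OF Some k c(2) E' V' U out', of "S - {c}"])
        show "S - {c} \<subseteq> set (?del c)" using S(1) by auto
        show "card (S - {c}) \<le> k - 1" using S(2) c finS by (simp add: card_Diff_singleton)
        show "(S - {c}) \<inter> set U = {}" using S(3) by blast
        have "set (?del c) - (S - {c}) = set V - S" using c by auto
        then show "\<not> biclique E i j (set (?del c) - (S - {c}))" using S(4) by simp
        \<comment> \<open>The deleted vertex moves from \<open>S\<close> to \<open>S0\<close>, so
          the covering family is unchanged and the new cardinality is paid for by the spent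
          deletion.\<close>
        have "card (insert c S0) + (k - 1) \<le> k0"
          using S0 k card_insert_le_m1[of "Suc (card S0)" S0 c] by simp
        moreover have "S - {c} \<union> insert c S0 = S \<union> S0" using c by blast
        ultimately have "\<exists>S0. finite S0 \<and> card S0 + (k - 1) \<le> k0 \<and> set U \<subseteq> (\<Union>s\<in>S - {c} \<union> S0. N s)"
          using S0 by (intro exI[of _ "insert c S0"]) simp
        then show "(\<forall>X\<in>set (cands E (?del c)). viol E i j (?del c) X \<longrightarrow> set X \<subseteq> set U) \<or>
          (\<exists>S0. finite S0 \<and> card S0 + (k - 1) \<le> k0 \<and> set U \<subseteq> (\<Union>s\<in>S - {c} \<union> S0. N s))" ..
      qed (rule L)
      then have "list_ex (\<lambda>c. solve E i j L (?del c) U (k - 1)) ?C"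
        using c(2) unfolding list_ex_iff by blast
      then show ?thesis using Some k by (subst solve.simps) simp
    next
      case True
      have XV: "set X \<subseteq> set V" and Xd: "distinct X" using cands_props[OF X(1)] V by auto
      have XS: "set X \<subseteq> set (filter (\<lambda>v. v \<notin> S) V)" using XV True by auto
      \<comment> \<open>\<open>S\<close> avoids \<open>X\<close>, so it must destroy the violation
        by hitting a common neighbour; otherwise \<open>X\<close> would still be violated in the
        graph without \<open>S\<close>.\<close>
      obtain s where s: "s \<in> S" "s \<in> set (common E X V)"
      proof (rule ccontr)
        assume "\<not> thesis"
        then have "S \<inter> set (common E X V) = {}" using that by blast
        then have "common E X (filter (\<lambda>v. v \<notin> S) V) = common E X V"
          unfolding common_def filter_filter by (intro filter_cong) auto
        then have "viol E i j (filter (\<lambda>v. v \<notin> S) V) X" using X(2) by (simp add: viol_def)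
        then have "biclique E i j (set V - S)"
          using viol_imp_biclique[OF ET] Xd XS V unfolding rest by auto
        with S(4) show False by contradiction
      qed
      \<comment> \<open>\<open>s\<close> is not a later neighbour of any \<open>x\<close> in
        \<open>X\<close>, because those were all offered for deletion and \<open>S\<close> avoids
        them. So each \<open>x\<close> is a later neighbour of \<open>s\<close>.\<close>
      have XN: "set X \<subseteq> N s"
      proof
        fix x assume x: "x \<in> set X"
        have "E s x" "s \<in> set V" using s(2) x by (auto simp: common_def)
        moreover have "x \<in> set V" using x XV by blast
        ultimately have "E x s" "s \<noteq> x" using E unfolding simple_on_def by blast+
        with \<open>E s x\<close> \<open>s \<in> set V\<close> \<open>x \<in> set V\<close> have "s \<in> set (out E V x) \<or> x \<in> set (out E V s)"
          by (intro out_or_out)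
        moreover have "s \<notin> set (out E V x)" using True s(1) x by auto
        ultimately show "x \<in> N s" using out by blast
      qed
      let ?U = "List.union X U"
      have sub: "set ?U \<subseteq> (\<Union>s\<in>S \<union> S0. N s)" using XN s(1) S0(3) by auto
      \<comment> \<open>At most \<open>k0\<close> sets of size at most \<open>d\<close> cover the
        enlarged \<open>U\<close>, so the test against \<open>L\<close> cannot reject it.\<close>
      have "length ?U = card (set ?U)" using U by (simp add: distinct_card[symmetric] del: set_union)
      also have "\<dots> \<le> card (\<Union>s\<in>S \<union> S0. N s)"
        using sub finS S0(1) N(1) by (intro card_mono) auto
      also have "\<dots> \<le> (\<Sum>s\<in>S \<union> S0. card (N s))"
        using finS S0(1) by (intro card_UN_le) auto
      also have "\<dots> \<le> card (S \<union> S0) * d"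
        using N(2) sum_bounded_above[of "S \<union> S0" "\<lambda>s. card (N s)" d] by simp
      also have "\<dots> \<le> k0 * d"
        using card_Un_le[of S S0] S(2) S0(2) by (intro mult_le_mono1) linarith
      finally have lenU: "length ?U \<le> L" using L by (simp add: mult.commute)
      show ?thesis
      proof (cases "if k = 0 then False else list_ex (\<lambda>c. solve E i j L (?del c) U (k - 1)) ?C")
        case True
        show ?thesis
          unfolding solve.simps[of E i j L V U k] Some option.case if_P[OF True] ..
      next
        case nC: False
        have "solve E i j L V ?U k"
        proof (rule 1(3)[OF Some nC lenU E V _ out S(1,2) _ S(4)])
          show "distinct ?U" using U by simp
          show "S \<inter> set ?U = {}" using S(3) True by auto
          show "(\<forall>Y\<in>set (cands E V). viol E i j V Y \<longrightarrow> set Y \<subseteq> set ?U) \<or>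
            (\<exists>S0. finite S0 \<and> card S0 + k \<le> k0 \<and> set ?U \<subseteq> (\<Union>s\<in>S \<union> S0. N s))"
            using S0(1,2) sub by blast
        qed (rule L)
        then show ?thesis
          unfolding solve.simps[of E i j L V U k] Some option.case using lenU by auto
      qed
    qed
  qed
qed

section \<open>Quality of the greedy order, and correctness from the initial state\<close>

lemma set_elim_order [simp]: "set (elim_order E V) = set V"
proof (induction E V rule: elim_order.induct)
  case (2 E v vs)
  then show ?case using argmin_in[of E "v # vs" v vs] by (auto simp: Let_def simp del: argmin.simps)
qed simp

lemma distinct_elim_order: "distinct V \<Longrightarrow> distinct (elim_order E V)"
proof (induction E V rule: elim_order.induct)
  case (2 E v vs)
  then show ?case by (auto simp: Let_def simp del: argmin.simps)
qed simp

text \<open>When \<open>b\<close> is chosen, the remaining vertices contain one with at most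
  \<open>D\<close> remaining neighbours, and \<open>b\<close> has no more than that one. These
  neighbours include all later neighbours of \<open>b\<close>.\<close>

lemma length_max_out_elim_order:
  assumes "\<And>W. W \<noteq> {} \<Longrightarrow> W \<subseteq> set V \<Longrightarrow> \<exists>v\<in>W. card {u \<in> W. E v u} \<le> D" "distinct V"
  shows "length (max_out E (elim_order E V)) \<le> D"
  using assms
proof (induction E V rule: elim_order.induct)
  case (2 E v vs)
  let ?V = "v # vs"
  define b where "b = argmin E ?V v vs"
  let ?V' = "filter (\<lambda>x. x \<noteq> b) ?V"
  have deg: "length (filter (E u) ?V) = card {w \<in> set ?V. E u w}" for u
    using 2(3) by (metis distinct_card distinct_filter set_filter)
  obtain u where u: "u \<in> set ?V" "card {w \<in> set ?V. E u w} \<le> D"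
    using 2(2)[of "set ?V"] by auto
  have "length (filter (E b) (elim_order E ?V')) = card {w \<in> set ?V'. E b w}"
    using 2(3) by (metis distinct_card distinct_filter set_filter distinct_elim_order set_elim_order)
  also have "\<dots> \<le> card {w \<in> set ?V. E b w}" by (intro card_mono) auto
  also have "\<dots> \<le> card {w \<in> set ?V. E u w}"
    using argmin_le[of u v vs E ?V] u(1) unfolding b_def deg by auto
  finally have "length (filter (E b) (elim_order E ?V')) \<le> D" using u(2) by linarith
  moreover have "length (max_out E (elim_order E ?V')) \<le> D"
  proof (rule 2(1)[OF b_def])
    fix W assume "W \<noteq> {}" "W \<subseteq> set ?V'"
    moreover from this have "W \<subseteq> set ?V" by (auto simp: set_filter simp del: filter.simps)
    ultimately show "\<exists>v\<in>W. card {u \<in> W. E v u} \<le> D" using 2(2) by blast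
  qed (use 2(3) in auto)
  moreover have "elim_order E ?V = b # elim_order E ?V'"
    by (simp only: elim_order.simps Let_def b_def)
  ultimately show ?case by (simp del: elim_order.simps max_out.simps filter.simps)
qed simp

text \<open>Here \<open>N s\<close> is the later neighbourhood in the initial order. With
  \<open>U\<close> empty, the cover condition holds for the empty \<open>S0\<close>.\<close>

lemma solve_correct:
  fixes E d k n
  defines "V \<equiv> elim_order E [0..<n]"
  assumes E: "simple_on E {..<n}" and d: "length (max_out E V) = d"
  shows "solve E i j (k * d) V [] k \<longleftrightarrow> (\<exists>S\<subseteq>{..<n}. card S \<le> k \<and> \<not> biclique E i j ({..<n} - S))"
proof -
  have V: "set V = {..<n}" "distinct V"
    by (auto simp: V_def distinct_elim_order)
  have EV: "simple_on E (set V)" using E V by simp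
  show ?thesis
  proof
    assume "solve E i j (k * d) V [] k"
    from solve_sound[OF this EV V(2)] show "\<exists>S\<subseteq>{..<n}. card S \<le> k \<and> \<not> biclique E i j ({..<n} - S)"
      unfolding V(1) .
  next
    assume "\<exists>S\<subseteq>{..<n}. card S \<le> k \<and> \<not> biclique E i j ({..<n} - S)"
    then obtain S where S: "S \<subseteq> set V" "card S \<le> k" "\<not> biclique E i j (set V - S)"
      unfolding V(1) by blast
    show "solve E i j (k * d) V [] k"
    proof (rule solve_complete[where N = "\<lambda>s. set (out E V s)" and d = d and ?k0.0 = k])
      show "card (set (out E V s)) \<le> d" for s
        using card_length[of "out E V s"] length_out[of E V s] d by linarith
      show "(\<forall>X\<in>set (cands E V). viol E i j V X \<longrightarrow> set X \<subseteq> set []) \<or>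
        (\<exists>S0. finite S0 \<and> card S0 + k \<le> k \<and> set [] \<subseteq> (\<Union>s\<in>S \<union> S0. set (out E V s)))"
        by (intro disjI2 exI[of _ "{}"]) simp
    qed (use EV V S in auto)
  qed
qed

text \<open>No subset of \<open>W\<close> has \<open>K\<close> or more elements, so every side size
  from \<open>K\<close> on is equally impossible. This lets the program replace \<open>i\<close> and
  \<open>j\<close>, possibly exponential in the input size, by small unary numbers.\<close>

lemma biclique_cap:
  assumes W: "finite W" "card W < K"
  shows "biclique E (min i K) (min j K) W \<longleftrightarrow> biclique E i j W"
proof -
  have lt: "card A < K" if "A \<subseteq> W" for A
    using card_mono[OF W(1) that] W(2) by linarith
  have min: "card A = min a K \<longleftrightarrow> card A = a" if "A \<subseteq> W" for A a
    using lt[OF that] by auto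
  show ?thesis unfolding biclique_def by (intro ex_cong1 conj_cong refl min)
qed

section \<open>Graphs and adjacency matrices\<close>

lemma contains_biclique_induce:
  assumes G: "pair_graph G" and X: "X \<subseteq> pverts G"
  shows "contains_biclique i j (with_proj G \<restriction> X) \<longleftrightarrow>
    (\<exists>A B. A \<subseteq> X \<and> B \<subseteq> X \<and> card A = i \<and> card B = j \<and> A \<times> B \<subseteq> parcs G)" (is "_ \<longleftrightarrow> ?R")
proof -
  interpret pair_graph G by fact
  have fin: "finite X" using X pair_finite_verts by (rule finite_subset)
  show ?thesis
  proof
    assume "contains_biclique i j (with_proj G \<restriction> X)"
    then obtain H A B where H: "subgraph H (with_proj G \<restriction> X)" "verts H = A \<union> B" "card A = i" "card B = j"
      "arcs_ends H = A \<times> B \<union> B \<times> A"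
      unfolding contains_biclique_def complete_bipartite_digraph_def by blast
    have "arcs_ends H \<subseteq> parcs G"
      using H(1) unfolding subgraph_def compatible_def arcs_ends_def arc_to_ends_def by auto
    moreover have "A \<subseteq> X" "B \<subseteq> X" using H(1,2) unfolding subgraph_def by auto
    ultimately show ?R using H(3-5) by blast
  next
    assume ?R
    then obtain A B where AB: "A \<subseteq> X" "B \<subseteq> X" "card A = i" "card B = j" "A \<times> B \<subseteq> parcs G" by blast
    \<comment> \<open>A vertex on both sides would give a loop.\<close>
    have disj: "A \<inter> B = {}" using AB(5) pair_no_loops by fastforce
    have BA: "B \<times> A \<subseteq> parcs G" using AB(5) pair_sym_arcs by (auto simp: symmetric_def dest: symD)
    define H where "H = \<lparr>pverts = A \<union> B, parcs = A \<times> B \<union> B \<times> A\<rparr>"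
    have K: "K\<^bsub>i,j\<^esub> (with_proj H)"
      unfolding complete_bipartite_digraph_pair_def using AB disj fin
      by (auto simp: H_def intro: finite_subset)
    then interpret H: pair_graph H by (rule pair_graphI_complete_bipartite)
    have "subgraph (with_proj H) (with_proj G \<restriction> X)"
    proof (rule subgraphI)
      show "wf_digraph (with_proj H)" by (rule H.wf_digraph_axioms)
      show "wf_digraph (with_proj G \<restriction> X)" by (rule wellformed_induce_subgraph)
    qed (use AB BA in \<open>auto simp: H_def compatible_def\<close>)
    with K show "contains_biclique i j (with_proj G \<restriction> X)" unfolding contains_biclique_def by blast
  qed
qed

lemma degeneracy_bound:
  assumes G: "pair_graph G" and X: "X \<subseteq> pverts G" "X \<noteq> {}"
  shows "\<exists>v\<in>X. card {u \<in> X. (v, u) \<in> parcs G} \<le> degeneracy (with_proj G)"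
proof -
  interpret pair_graph G by fact
  define H where "H = \<lparr>pverts = X, parcs = parcs G \<inter> X \<times> X\<rparr>"
  have fin: "finite X" using X pair_finite_verts finite_subset by blast
  interpret H: pair_graph H
    by unfold_locales
      (use fin pair_finite_arcs pair_no_loops pair_sym_arcs in \<open>auto simp: H_def symmetric_def sym_def\<close>)
  let ?P = "\<lambda>d. \<forall>H. subgraph H (with_proj G) \<and> graph H \<and> verts H \<noteq> {} \<longrightarrow> (\<exists>v \<in> verts H. out_degree H v \<le> d)"
  \<comment> \<open>\<open>LEAST\<close> is meaningful only if some bound exists; the number of arcs
    is one, as it bounds every out-degree.\<close>
  have "?P (card (parcs G))"
  proof (intro allI impI)
    fix H :: "(_, _) pre_digraph"
    assume H: "subgraph H (with_proj G) \<and> graph H \<and> verts H \<noteq> {}"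
    then obtain v where "v \<in> verts H" by blast
    moreover have "out_degree H v \<le> card (parcs G)"
      unfolding out_degree_def using H pair_finite_arcs
      by (intro card_mono) (auto simp: subgraph_def out_arcs_def)
    ultimately show "\<exists>v\<in>verts H. out_degree H v \<le> card (parcs G)" by blast
  qed
  then have P: "?P (degeneracy (with_proj G))" unfolding degeneracy_def by (rule LeastI)
  have "subgraph (with_proj H) (with_proj G)"
  proof (rule subgraphI)
    show "wf_digraph (with_proj H)" by (rule H.wf_digraph_axioms)
    show "wf_digraph (with_proj G)" by (rule wf_digraph_axioms)
  qed (use X in \<open>auto simp: H_def compatible_def\<close>)
  moreover have "graph (with_proj H)" by (rule H.graph_axioms)
  ultimately obtain v where v: "v \<in> X" "out_degree (with_proj H) v \<le> degeneracy (with_proj G)"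
    using P[rule_format, of "with_proj H"] X(2) by (auto simp: H_def)
  have "out_arcs (with_proj H) v = Pair v ` {u \<in> X. (v, u) \<in> parcs G}"
    using v(1) by (auto simp: out_arcs_def H_def)
  then have "out_degree (with_proj H) v = card {u \<in> X. (v, u) \<in> parcs G}"
    unfolding out_degree_def by (simp add: card_image inj_on_def)
  with v show ?thesis by auto
qed

lemma adj_matrix_props:
  assumes "finite (pverts G)"
  defines "vs \<equiv> sorted_list_of_set (pverts G)"
  shows "length (adj_matrix G) = length vs"
    and "r \<in> set (adj_matrix G) \<Longrightarrow> length r = length (adj_matrix G)"
    and "u < length vs \<Longrightarrow> v < length vs \<Longrightarrow> adj_matrix G ! u ! v \<longleftrightarrow> (vs ! u, vs ! v) \<in> parcs G"
    and "bij_betw ((!) vs) {..<length vs} (pverts G)"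
  using assms by (auto simp: adj_matrix_def Let_def intro!: bij_betw_nth)

text \<open>Positions in the sorted vertex list replace vertex names. This indexing is injective, so
  it preserves the sizes of both sides.\<close>

lemma contains_biclique_adj_matrix:
  assumes G: "pair_graph G"
  defines "vs \<equiv> sorted_list_of_set (pverts G)" and "M \<equiv> adj_matrix G"
  assumes W: "W \<subseteq> {..<length M}"
  shows "contains_biclique i j (with_proj G \<restriction> ((!) vs ` W)) \<longleftrightarrow> biclique (\<lambda>u v. M ! u ! v) i j W"
proof -
  interpret pair_graph G by fact
  note adj = adj_matrix_props[OF pair_finite_verts, folded vs_def M_def]
  have W: "W \<subseteq> {..<length vs}" using W adj(1) by simp
  have inj: "inj_on ((!) vs) W" using adj(4) W by (auto simp: bij_betw_def intro: inj_on_subset)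
  have img: "(!) vs ` W \<subseteq> pverts G" using adj(4) W by (auto simp: bij_betw_def)
  have arcs: "(!) vs ` A \<times> (!) vs ` B \<subseteq> parcs G \<longleftrightarrow> (\<forall>a\<in>A. \<forall>b\<in>B. M ! a ! b)"
    if "A \<subseteq> W" "B \<subseteq> W" for A B
  proof -
    have "(vs ! a, vs ! b) \<in> parcs G \<longleftrightarrow> M ! a ! b" if "a \<in> A" "b \<in> B" for a b
      using that \<open>A \<subseteq> W\<close> \<open>B \<subseteq> W\<close> W adj(3)[of a b] by (auto simp: subset_eq)
    moreover have "(!) vs ` A \<times> (!) vs ` B \<subseteq> parcs G \<longleftrightarrow> (\<forall>a\<in>A. \<forall>b\<in>B. (vs ! a, vs ! b) \<in> parcs G)"
      by blast
    ultimately show ?thesis by auto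
  qed
  have "(\<exists>A B. A \<subseteq> (!) vs ` W \<and> B \<subseteq> (!) vs ` W \<and> card A = i \<and> card B = j \<and> A \<times> B \<subseteq> parcs G) \<longleftrightarrow>
    (\<exists>A B. A \<subseteq> W \<and> B \<subseteq> W \<and> card ((!) vs ` A) = i \<and> card ((!) vs ` B) = j \<and>
      (!) vs ` A \<times> (!) vs ` B \<subseteq> parcs G)"
    unfolding subset_image_iff by blast
  also have "\<dots> \<longleftrightarrow> biclique (\<lambda>u v. M ! u ! v) i j W"
    unfolding biclique_def
    by (intro ex_cong1 conj_cong refl) (simp_all add: arcs card_image[OF inj_on_subset[OF inj]])
  finally show ?thesis unfolding contains_biclique_induce[OF G img] .
qed

lemma bfvd_adj_matrix:
  assumes G: "pair_graph G"
  defines "M \<equiv> adj_matrix G"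
  shows "bfvd i j k (with_proj G) \<longleftrightarrow>
    (\<exists>S\<subseteq>{..<length M}. card S \<le> k \<and> \<not> biclique (\<lambda>u v. M ! u ! v) i j ({..<length M} - S))"
proof -
  interpret pair_graph G by fact
  define vs where "vs = sorted_list_of_set (pverts G)"
  note adj = adj_matrix_props[OF pair_finite_verts, folded vs_def M_def]
  have bij: "inj_on ((!) vs) {..<length M}" "pverts G = (!) vs ` {..<length M}"
    using adj(1,4) by (auto simp: bij_betw_def)
  have "bfvd i j k (with_proj G) \<longleftrightarrow> (\<exists>S\<subseteq>{..<length M}. card ((!) vs ` S) \<le> k \<and>
      \<not> contains_biclique i j (with_proj G \<restriction> ((!) vs ` {..<length M} - (!) vs ` S)))"
    unfolding bfvd_def by (simp add: bij(2) subset_image_iff) blast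
  also have "\<dots> \<longleftrightarrow> (\<exists>S\<subseteq>{..<length M}. card S \<le> k \<and> \<not> biclique (\<lambda>u v. M ! u ! v) i j ({..<length M} - S))"
  proof (intro ex_cong1 conj_cong refl)
    fix S assume S: "S \<subseteq> {..<length M}"
    show "(card ((!) vs ` S) \<le> k) = (card S \<le> k)"
      using card_image[OF inj_on_subset[OF bij(1) S]] by simp
    have "(!) vs ` {..<length M} - (!) vs ` S = (!) vs ` ({..<length M} - S)"
      using inj_on_image_set_diff[OF bij(1) _ S] by auto
    then show "(\<not> contains_biclique i j (with_proj G \<restriction> ((!) vs ` {..<length M} - (!) vs ` S))) =
        (\<not> biclique (\<lambda>u v. M ! u ! v) i j ({..<length M} - S))"
      using contains_biclique_adj_matrix[OF G, of "{..<length M} - S"] unfolding M_def vs_def by auto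
  qed
  finally show ?thesis .
qed

text \<open>Provides the hypothesis of \<open>length_max_out_elim_order\<close> with the degeneracy
  as \<open>D\<close>.\<close>

lemma degeneracy_adj_matrix:
  assumes G: "pair_graph G" and W: "W \<noteq> {}" "W \<subseteq> {..<length (adj_matrix G)}"
  shows "\<exists>v\<in>W. card {u \<in> W. adj_matrix G ! v ! u} \<le> degeneracy (with_proj G)"
proof -
  interpret pair_graph G by fact
  define vs where "vs = sorted_list_of_set (pverts G)"
  note adj = adj_matrix_props[OF pair_finite_verts, folded vs_def]
  have W': "W \<subseteq> {..<length vs}" using W adj(1) by simp
  have inj: "inj_on ((!) vs) W" using adj(4) W' by (auto simp: bij_betw_def intro: inj_on_subset)
  have "(!) vs ` W \<subseteq> pverts G" using adj(4) W' by (auto simp: bij_betw_def)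
  from degeneracy_bound[OF G this] W(1) obtain v where v: "v \<in> W"
    "card {u \<in> (!) vs ` W. (vs ! v, u) \<in> parcs G} \<le> degeneracy (with_proj G)" by auto
  have "adj_matrix G ! v ! u \<longleftrightarrow> (vs ! v, vs ! u) \<in> parcs G" if "u \<in> W" for u
    using that v(1) W' adj(3)[of v u] by (auto simp: subset_eq)
  then have "{u \<in> (!) vs ` W. (vs ! v, u) \<in> parcs G} = (!) vs ` {u \<in> W. adj_matrix G ! v ! u}"
    by auto
  then have "card {u \<in> (!) vs ` W. (vs ! v, u) \<in> parcs G} = card {u \<in> W. adj_matrix G ! v ! u}"
    using card_image[OF inj_on_subset[OF inj, of "{u \<in> W. adj_matrix G ! v ! u}"]] by auto
  with v show ?thesis by auto
qed

section \<open>Symbolic execution of programs\<close>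

text \<open>Weakest precondition for total correctness, with a postcondition that also sees the step
  count. As evaluation is deterministic, asserting one evaluation asserts the only one.\<close>

definition wp :: "program \<Rightarrow> val list \<Rightarrow> expr \<Rightarrow> (val \<Rightarrow> nat \<Rightarrow> bool) \<Rightarrow> bool" where
  "wp P env e Q \<longleftrightarrow> (\<exists>v t. evaluates P env e v t \<and> Q v t)"

definition wps :: "program \<Rightarrow> val list \<Rightarrow> expr list \<Rightarrow> (val list \<Rightarrow> nat \<Rightarrow> bool) \<Rightarrow> bool" where
  "wps P env es Q \<longleftrightarrow> (\<exists>vs t. evaluates_list P env es vs t \<and> Q vs t)"

text \<open>Calls have a constant of their own without a simplification rule, so that symbolic
  execution stops there and a proved \<open>computes\<close> fact is applied instead of unfolding
  the callee.\<close>

definition wpc :: "program \<Rightarrow> nat \<Rightarrow> val list \<Rightarrow> (val \<Rightarrow> nat \<Rightarrow> bool) \<Rightarrow> bool" where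
  "wpc P f vs Q \<longleftrightarrow> wp P vs (P ! f) Q"

definition computes :: "program \<Rightarrow> nat \<Rightarrow> val list \<Rightarrow> val \<Rightarrow> nat \<Rightarrow> bool" where
  "computes P f vs v T \<longleftrightarrow> wpc P f vs (\<lambda>w t. w = v \<and> t \<le> T)"

text \<open>
  The equations below let the simplifier execute a program symbolically; the weak congruence rules
  keep it from entering a continuation before its arguments are known.
\<close>

lemma wp_cong [cong]: "env = env' \<Longrightarrow> wp P env e Q = wp P env' e Q"
  by simp

lemma wps_cong [cong]: "env = env' \<Longrightarrow> wps P env es Q = wps P env' es Q"
  by simp

lemma wpc_cong [cong]: "vs = vs' \<Longrightarrow> wpc P f vs Q = wpc P f vs' Q"
  by simp

lemmas evaluates_intros =
  evaluates_evaluates_list.intros[unfolded One_nat_def add_Suc_right add_0_right]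

lemma wp_Var [simp]: "wp P env (Var n) Q \<longleftrightarrow> n < length env \<and> Q (env ! n) 1"
  unfolding wp_def One_nat_def add_Suc_right add_0_right
  by (blast intro: evaluates_intros elim: evaluates_VarE)

lemma wp_LeafE [simp]: "wp P env LeafE Q \<longleftrightarrow> Q Leaf 1"
  unfolding wp_def One_nat_def add_Suc_right add_0_right
  by (blast intro: evaluates_intros elim: evaluates_LeafE)

lemma wp_NodeE [simp]: "wp P env (NodeE a b) Q \<longleftrightarrow>
    wp P env a (\<lambda>v s. wp P env b (\<lambda>w t. Q (Node v w) (s + t + 1)))"
  unfolding wp_def One_nat_def add_Suc_right add_0_right
  by (blast intro: evaluates_intros elim: evaluates_NodeE)

lemma wp_FstE [simp]: "wp P env (FstE a) Q \<longleftrightarrow> wp P env a (\<lambda>v t. Q (fst_val v) (t + 1))"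
  unfolding wp_def One_nat_def add_Suc_right add_0_right
  by (blast intro: evaluates_intros elim: evaluates_FstE)

lemma wp_SndE [simp]: "wp P env (SndE a) Q \<longleftrightarrow> wp P env a (\<lambda>v t. Q (snd_val v) (t + 1))"
  unfolding wp_def One_nat_def add_Suc_right add_0_right
  by (blast intro: evaluates_intros elim: evaluates_SndE)

lemma wp_IfE [simp]: "wp P env (IfE c a b) Q \<longleftrightarrow>
    wp P env c (\<lambda>w s. if w = Leaf then wp P env b (\<lambda>v t. Q v (s + t + 1))
                      else wp P env a (\<lambda>v t. Q v (s + t + 1)))"
  unfolding wp_def One_nat_def add_Suc_right add_0_right if_bool_eq_conj
  by (blast intro: evaluates_intros elim: evaluates_IfE)

lemma wp_LetE [simp]: "wp P env (LetE a b) Q \<longleftrightarrow>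
    wp P env a (\<lambda>w s. wp P (w # env) b (\<lambda>v t. Q v (s + t + 1)))"
  unfolding wp_def One_nat_def add_Suc_right add_0_right
  by (blast intro: evaluates_intros elim: evaluates_LetE)

lemma wp_Call [simp]: "wp P env (Call f es) Q \<longleftrightarrow> f < length P \<and>
    wps P env es (\<lambda>vs s. wpc P f vs (\<lambda>v t. Q v (s + t + 1)))"
  unfolding wp_def wps_def wpc_def One_nat_def add_Suc_right add_0_right
  by (blast intro: evaluates_intros elim: evaluates_CallE)

lemma wps_Nil [simp]: "wps P env [] Q \<longleftrightarrow> Q [] 0"
  unfolding wps_def by (blast intro: evaluates_intros elim: evaluates_list_NilE)

lemma wps_Cons [simp]: "wps P env (e # es) Q \<longleftrightarrow>
    wp P env e (\<lambda>v s. wps P env es (\<lambda>vs t. Q (v # vs) (s + t)))"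
  unfolding wp_def wps_def by (blast intro: evaluates_intros elim: evaluates_list_ConsE)

lemma wp_mono: "wp P env e Q \<Longrightarrow> (\<And>v t. Q v t \<Longrightarrow> R v t) \<Longrightarrow> wp P env e R"
  unfolding wp_def by blast

text \<open>Only an upper bound for the time of the callee is known, so the continuation has to hold
  for every \<open>t\<close> up to that bound.\<close>

lemma wpc_computes:
  assumes "computes P f vs v T" and "\<And>t. t \<le> T \<Longrightarrow> Q v t"
  shows "wpc P f vs Q"
  using assms unfolding computes_def wpc_def by (auto elim: wp_mono)

lemma computes_mono: "computes P f vs v S \<Longrightarrow> S \<le> T \<Longrightarrow> computes P f vs v T"
  unfolding computes_def wpc_def by (erule wp_mono) simp

lemma computesI: "wp P vs (P ! f) (\<lambda>w t. w = v \<and> t \<le> T) \<Longrightarrow> computes P f vs v T"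
  unfolding computes_def wpc_def .

named_theorems calls

section \<open>The program\<close>

text \<open>
  Numbers are passed in unary. The \<^const>\<open>Var\<close> indices refer to these argument lists:
  \<open>solve\<close> takes \<open>M, i, j, L, V, U, k\<close> and \<open>any\<close> in addition the list of vertices to be tried for
  deletion; \<open>nbrs\<close> takes \<open>M, v, V\<close>; \<open>all_adj\<close> takes \<open>M, v, X\<close>; \<open>common\<close> takes \<open>M, X, V\<close>; \<open>viol\<close> takes
  \<open>i, j, X, C\<close> with \<open>C\<close> the common neighbours of \<open>X\<close>; \<open>good\<close> and \<open>find\<close> take \<open>M, i, j, V, U, fl\<close>, where
  \<open>fl\<close> tells whether candidates inside \<open>U\<close> count, and a candidate or a list of candidates;
  \<open>union\<close> takes \<open>X, U\<close>; \<open>out\<close> and \<open>outs\<close> take \<open>M, V\<close> and a vertex or a list; \<open>same_type\<close> takes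
  \<open>M, b, c, U\<close>; \<open>has_type\<close> takes \<open>M, U, b, bs\<close>; \<open>reps\<close> takes \<open>M, U, V\<close>; \<open>argmin\<close> takes \<open>M, V, b, vs\<close>;
  \<open>unary\<close> takes a list of bits and a list whose length caps the result, because binary numbers may
  be exponential in the size of the input.
\<close>

abbreviation (input) "TrueE \<equiv> NodeE LeafE LeafE"
abbreviation (input) "eq_fn \<equiv> 1::nat"
abbreviation (input) "leq_fn \<equiv> 2::nat"
abbreviation (input) "nth_fn \<equiv> 3::nat"
abbreviation (input) "app_fn \<equiv> 4::nat"
abbreviation (input) "mem_fn \<equiv> 5::nat"
abbreviation (input) "nbrs_fn \<equiv> 6::nat"
abbreviation (input) "all_adj_fn \<equiv> 7::nat"
abbreviation (input) "common_fn \<equiv> 8::nat"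
abbreviation (input) "remove_fn \<equiv> 9::nat"
abbreviation (input) "map_cons_fn \<equiv> 10::nat"
abbreviation (input) "subseqs_fn \<equiv> 11::nat"
abbreviation (input) "cands_fn \<equiv> 12::nat"
abbreviation (input) "subset_fn \<equiv> 13::nat"
abbreviation (input) "viol_fn \<equiv> 14::nat"
abbreviation (input) "find_fn \<equiv> 15::nat"
abbreviation (input) "good_fn \<equiv> 16::nat"
abbreviation (input) "union_fn \<equiv> 17::nat"
abbreviation (input) "out_fn \<equiv> 18::nat"
abbreviation (input) "outs_fn \<equiv> 19::nat"
abbreviation (input) "same_type_fn \<equiv> 20::nat"
abbreviation (input) "has_type_fn \<equiv> 21::nat"
abbreviation (input) "reps_fn \<equiv> 22::nat"
abbreviation (input) "argmin_fn \<equiv> 23::nat"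
abbreviation (input) "order_fn \<equiv> 24::nat"
abbreviation (input) "iota_fn \<equiv> 25::nat"
abbreviation (input) "max_out_fn \<equiv> 26::nat"
abbreviation (input) "rep_fn \<equiv> 27::nat"
abbreviation (input) "trunc_fn \<equiv> 28::nat"
abbreviation (input) "unary_fn \<equiv> 29::nat"
abbreviation (input) "solve_fn \<equiv> 30::nat"
abbreviation (input) "any_fn \<equiv> 31::nat"

definition "eq_body = IfE (Var 0)
  (IfE (Var 1) (Call eq_fn [SndE (Var 0), SndE (Var 1)]) LeafE)
  (IfE (Var 1) LeafE TrueE)"

definition "leq_body = IfE (Var 0)
  (IfE (Var 1) (Call leq_fn [SndE (Var 0), SndE (Var 1)]) LeafE)
  TrueE"

definition "nth_body = IfE (Var 1)
  (Call nth_fn [SndE (Var 0), SndE (Var 1)])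
  (FstE (Var 0))"

definition "app_body = IfE (Var 0)
  (NodeE (FstE (Var 0)) (Call app_fn [SndE (Var 0), Var 1]))
  (Var 1)"

definition "mem_body = IfE (Var 1)
  (IfE (Call eq_fn [Var 0, FstE (Var 1)]) TrueE (Call mem_fn [Var 0, SndE (Var 1)]))
  LeafE"

abbreviation (input) "adjE m u v \<equiv> Call nth_fn [Call nth_fn [m, u], v]"

definition "nbrs_body = IfE (Var 2)
  (IfE (adjE (Var 0) (Var 1) (FstE (Var 2)))
    (NodeE (FstE (Var 2)) (Call nbrs_fn [Var 0, Var 1, SndE (Var 2)]))
    (Call nbrs_fn [Var 0, Var 1, SndE (Var 2)]))
  LeafE"

definition "all_adj_body = IfE (Var 2)
  (IfE (adjE (Var 0) (Var 1) (FstE (Var 2)))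
    (Call all_adj_fn [Var 0, Var 1, SndE (Var 2)])
    LeafE)
  TrueE"

definition "common_body = IfE (Var 2)
  (IfE (Call all_adj_fn [Var 0, FstE (Var 2), Var 1])
    (NodeE (FstE (Var 2)) (Call common_fn [Var 0, Var 1, SndE (Var 2)]))
    (Call common_fn [Var 0, Var 1, SndE (Var 2)]))
  LeafE"

definition "remove_body = IfE (Var 1)
  (IfE (Call eq_fn [Var 0, FstE (Var 1)])
    (Call remove_fn [Var 0, SndE (Var 1)])
    (NodeE (FstE (Var 1)) (Call remove_fn [Var 0, SndE (Var 1)])))
  LeafE"

definition "map_cons_body = IfE (Var 1)
  (NodeE (NodeE (Var 0) (FstE (Var 1))) (Call map_cons_fn [Var 0, SndE (Var 1), Var 2]))
  (Var 2)"

definition "subseqs_body = IfE (Var 0)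
  (LetE (Call subseqs_fn [SndE (Var 0)])
    (Call map_cons_fn [FstE (Var 1), Var 0, Var 0]))
  (NodeE LeafE LeafE)"

definition "cands_body = IfE (Var 1)
  (Call app_fn [Call subseqs_fn [Call nbrs_fn [Var 0, FstE (Var 1), SndE (Var 1)]],
                Call cands_fn [Var 0, SndE (Var 1)]])
  (NodeE LeafE LeafE)"

definition "subset_body = IfE (Var 0)
  (IfE (Call mem_fn [FstE (Var 0), Var 1])
    (Call subset_fn [SndE (Var 0), Var 1])
    LeafE)
  TrueE"

definition "viol_body = IfE (Call leq_fn [Var 2, Var 0])
  (IfE (Call leq_fn [Var 0, Var 2]) (Call leq_fn [Var 1, Var 3]) LeafE)
  LeafE"

definition "good_body =
  LetE (Call common_fn [Var 0, Var 6, Var 3])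
    (IfE (IfE (Call viol_fn [Var 2, Var 3, Var 7, Var 0]) TrueE
              (Call viol_fn [Var 3, Var 2, Var 7, Var 0]))
      (IfE (Var 6) TrueE (IfE (Call subset_fn [Var 7, Var 5]) LeafE TrueE))
      LeafE)"

definition "find_body = IfE (Var 6)
  (IfE (Call good_fn [Var 0, Var 1, Var 2, Var 3, Var 4, Var 5, FstE (Var 6)])
    (NodeE (FstE (Var 6)) LeafE)
    (Call find_fn [Var 0, Var 1, Var 2, Var 3, Var 4, Var 5, SndE (Var 6)]))
  LeafE"

definition "union_body = IfE (Var 0)
  (IfE (Call mem_fn [FstE (Var 0), Var 1])
    (Call union_fn [SndE (Var 0), Var 1])
    (Call union_fn [SndE (Var 0), NodeE (FstE (Var 0)) (Var 1)]))
  (Var 1)"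

definition "out_body = IfE (Var 1)
  (IfE (Call eq_fn [Var 2, FstE (Var 1)])
    (Call nbrs_fn [Var 0, Var 2, SndE (Var 1)])
    (Call out_fn [Var 0, SndE (Var 1), Var 2]))
  LeafE"

definition "outs_body = IfE (Var 2)
  (Call app_fn [Call out_fn [Var 0, Var 1, FstE (Var 2)], Call outs_fn [Var 0, Var 1, SndE (Var 2)]])
  LeafE"

definition "same_type_body = IfE (Var 3)
  (IfE (adjE (Var 0) (Var 1) (FstE (Var 3)))
    (IfE (adjE (Var 0) (Var 2) (FstE (Var 3)))
      (Call same_type_fn [Var 0, Var 1, Var 2, SndE (Var 3)])
      LeafE)
    (IfE (adjE (Var 0) (Var 2) (FstE (Var 3)))
      LeafE
      (Call same_type_fn [Var 0, Var 1, Var 2, SndE (Var 3)])))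
  TrueE"

definition "has_type_body = IfE (Var 3)
  (IfE (Call same_type_fn [Var 0, Var 2, FstE (Var 3), Var 1])
    TrueE
    (Call has_type_fn [Var 0, Var 1, Var 2, SndE (Var 3)]))
  LeafE"

definition "reps_body = IfE (Var 2)
  (IfE (Call has_type_fn [Var 0, Var 1, FstE (Var 2), SndE (Var 2)])
    (Call reps_fn [Var 0, Var 1, SndE (Var 2)])
    (NodeE (FstE (Var 2)) (Call reps_fn [Var 0, Var 1, SndE (Var 2)])))
  LeafE"

definition "argmin_body = IfE (Var 3)
  (IfE (Call leq_fn [Call nbrs_fn [Var 0, Var 2, Var 1], Call nbrs_fn [Var 0, FstE (Var 3), Var 1]])
    (Call argmin_fn [Var 0, Var 1, Var 2, SndE (Var 3)])
    (Call argmin_fn [Var 0, Var 1, FstE (Var 3), SndE (Var 3)]))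
  (Var 2)"

definition "order_body = IfE (Var 1)
  (LetE (Call argmin_fn [Var 0, Var 1, FstE (Var 1), SndE (Var 1)])
    (NodeE (Var 0) (Call order_fn [Var 1, Call remove_fn [Var 0, Var 2]])))
  LeafE"

definition "iota_body = IfE (Var 0)
  (NodeE (Var 1) (Call iota_fn [SndE (Var 0), NodeE LeafE (Var 1)]))
  LeafE"

definition "max_out_body = IfE (Var 1)
  (LetE (Call nbrs_fn [Var 0, FstE (Var 1), SndE (Var 1)])
    (LetE (Call max_out_fn [Var 1, SndE (Var 2)])
      (IfE (Call leq_fn [Var 1, Var 0]) (Var 0) (Var 1))))
  LeafE"

text \<open>Multiplication in unary: \<open>k\<close> copies of a list of length \<open>d\<close>
  make a list of length \<open>k * d\<close>. Its entries are irrelevant, as \<open>L\<close> is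
  only compared by length.\<close>

definition "rep_body = IfE (Var 0)
  (Call app_fn [Var 1, Call rep_fn [SndE (Var 0), Var 1]])
  LeafE"

definition "trunc_body = IfE (Var 0)
  (IfE (Var 1) (NodeE LeafE (Call trunc_fn [SndE (Var 0), SndE (Var 1)])) LeafE)
  LeafE"

text \<open>Horner's scheme on the bits, cut off after every doubling so that no intermediate value
  exceeds twice the cap plus one.\<close>

definition "unary_body = IfE (Var 0)
  (LetE (Call unary_fn [SndE (Var 0), Var 1])
    (LetE (Call app_fn [Var 0, Var 0])
      (Call trunc_fn [IfE (FstE (Var 2)) (NodeE LeafE (Var 0)) (Var 0), Var 3])))
  LeafE"

definition "solve_body =
  LetE (Call cands_fn [Var 0, Var 4])
   (LetE (Call find_fn [Var 1, Var 2, Var 3, Var 5, Var 6, LeafE, Var 0])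
     (IfE (Var 0)
       (IfE (IfE (Var 8)
              (Call any_fn [Var 2, Var 3, Var 4, Var 5, Var 6, Var 7, SndE (Var 8),
                 Call app_fn [FstE (Var 0), Call outs_fn [Var 2, Var 6, FstE (Var 0)]]])
              LeafE)
         TrueE
         (LetE (Call union_fn [FstE (Var 0), Var 7])
           (IfE (Call leq_fn [Var 0, Var 6])
             (Call solve_fn [Var 3, Var 4, Var 5, Var 6, Var 7, Var 0, Var 9])
             LeafE)))
       (IfE (Call find_fn [Var 2, Var 3, Var 4, Var 6, Var 7, TrueE, Var 1])
         (IfE (Var 8)
           (Call any_fn [Var 2, Var 3, Var 4, Var 5, Var 6, Var 7, SndE (Var 8),
              Call reps_fn [Var 2, Var 7, Var 6]])
           LeafE)
         TrueE)))"

definition "any_body = IfE (Var 7)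
  (IfE (Call solve_fn [Var 0, Var 1, Var 2, Var 3, Call remove_fn [FstE (Var 7), Var 4], Var 5, Var 6])
    TrueE
    (Call any_fn [Var 0, Var 1, Var 2, Var 3, Var 4, Var 5, Var 6, SndE (Var 7)]))
  LeafE"

text \<open>The caps differ on purpose. Sides are capped at one more than the number
  \<open>n\<close> of vertices, since a cap at \<open>n\<close> could turn an impossible size into
  the possible size \<open>n\<close>; \<open>k\<close> is capped at \<open>n\<close>, as more cannot
  be deleted.\<close>

definition "main_body =
  LetE (FstE (Var 0))
   (LetE (Call unary_fn [FstE (SndE (Var 1)), NodeE LeafE (Var 0)])
    (LetE (Call unary_fn [FstE (SndE (SndE (Var 2))), NodeE LeafE (Var 1)])
     (LetE (Call unary_fn [SndE (SndE (SndE (Var 3))), Var 2])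
      (LetE (Call order_fn [Var 3, Call iota_fn [Var 3, LeafE]])
        (Call solve_fn [Var 4, Var 3, Var 2,
           Call rep_fn [Var 1, Call max_out_fn [Var 4, Var 0]], Var 0, LeafE, Var 1])))))"

definition prog :: program where
  "prog = [main_body, eq_body, leq_body, nth_body, app_body, mem_body, nbrs_body, all_adj_body,
    common_body, remove_body, map_cons_body, subseqs_body, cands_body, subset_body, viol_body,
    find_body, good_body, union_body, out_body, outs_body, same_type_body, has_type_body,
    reps_body, argmin_body, order_body, iota_body, max_out_body, rep_body, trunc_body, unary_body,
    solve_body, any_body]"

lemma length_prog [simp]: "length prog = 32"
  by (simp add: prog_def)

lemma prog_nth:
  "prog ! 0 = main_body" "prog ! 1 = eq_body" "prog ! 2 = leq_body" "prog ! 3 = nth_body"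
  "prog ! 4 = app_body" "prog ! 5 = mem_body" "prog ! 6 = nbrs_body" "prog ! 7 = all_adj_body"
  "prog ! 8 = common_body" "prog ! 9 = remove_body" "prog ! 10 = map_cons_body"
  "prog ! 11 = subseqs_body" "prog ! 12 = cands_body" "prog ! 13 = subset_body"
  "prog ! 14 = viol_body" "prog ! 15 = find_body" "prog ! 16 = good_body" "prog ! 17 = union_body"
  "prog ! 18 = out_body" "prog ! 19 = outs_body" "prog ! 20 = same_type_body"
  "prog ! 21 = has_type_body" "prog ! 22 = reps_body" "prog ! 23 = argmin_body"
  "prog ! 24 = order_body" "prog ! 25 = iota_body" "prog ! 26 = max_out_body"
  "prog ! 27 = rep_body" "prog ! 28 = trunc_body" "prog ! 29 = unary_body"
  "prog ! 30 = solve_body" "prog ! 31 = any_body"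
  by (simp_all add: prog_def)

section \<open>Running times\<close>

fun un :: "nat \<Rightarrow> val" where
  "un 0 = Leaf"
| "un (Suc n) = Node Leaf (un n)"

fun spine :: "val \<Rightarrow> nat" where
  "spine Leaf = 0"
| "spine (Node x y) = Suc (spine y)"

lemma spine_un [simp]: "spine (un n) = n"
  by (induction n) auto

lemma spine_enc_list [simp]: "spine (enc_list f xs) = length xs"
  by (induction xs) auto

lemma un_eq_Leaf [simp]: "un n = Leaf \<longleftrightarrow> n = 0"
  by (cases n) auto

lemma enc_bool_eq_Leaf [simp]: "enc_bool b = Leaf \<longleftrightarrow> \<not> b"
  by (cases b) auto

lemma enc_list_eq_Leaf [simp]: "enc_list f xs = Leaf \<longleftrightarrow> xs = []"
  by (cases xs) auto

section \<open>Cost of the operations on unary numbers and lists\<close>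

lemma eq_computes: "computes prog eq_fn [un x, un y] (enc_bool (x = y)) (20 * (x + 1))"
proof (induction x arbitrary: y)
  case 0
  show ?case by (cases y; rule computesI, unfold prog_nth eq_body_def, simp)
next
  case (Suc x)
  show ?case
    by (cases y; rule computesI, unfold prog_nth eq_body_def,
        (simp | rule wpc_computes[OF Suc.IH])+)
qed
lemmas [calls] = wpc_computes[OF eq_computes]

text \<open>Only spines are inspected, so lists and unary numbers can be compared with each other;
  the recursion ends with the shorter one.\<close>

lemma leq_computes:
  "computes prog leq_fn [x, y] (enc_bool (spine x \<le> spine y)) (20 * (spine x + 1))"
proof (induction x arbitrary: y)
  case Leaf
  show ?case by (rule computesI, unfold prog_nth leq_body_def, simp)
next
  case (Node x1 x2)
  show ?case
    by (cases y; rule computesI, unfold prog_nth leq_body_def,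
        (simp | rule wpc_computes[OF Node.IH(2)])+)
qed
lemmas [calls] = wpc_computes[OF leq_computes]

lemma nth_computes:
  "n < length xs \<Longrightarrow> computes prog nth_fn [enc_list f xs, un n] (f (xs ! n)) (20 * (n + 1))"
proof (induction n arbitrary: xs)
  case 0
  then show ?case by (cases xs; simp) (rule computesI, unfold prog_nth nth_body_def, simp)
next
  case (Suc n)
  then obtain y ys where xs: "xs = y # ys" "n < length ys" by (cases xs) auto
  show ?case unfolding xs
    by (rule computesI, unfold prog_nth nth_body_def,
        (simp | rule wpc_computes[OF Suc.IH[OF xs(2)]])+)
qed

fun app_val :: "val \<Rightarrow> val \<Rightarrow> val" where
  "app_val Leaf y = y"
| "app_val (Node a b) y = Node a (app_val b y)"

lemma app_val_enc_list [simp]: "app_val (enc_list f xs) (enc_list f ys) = enc_list f (xs @ ys)"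
  by (induction xs) auto

lemma app_val_un [simp]: "app_val (un m) (un n) = un (m + n)"
  by (induction m) auto

lemma spine_app_val [simp]: "spine (app_val x y) = spine x + spine y"
  by (induction x) auto

lemma app_computes: "computes prog app_fn [x, y] (app_val x y) (20 * (spine x + 1))"
proof (induction x)
  case Leaf
  show ?case by (rule computesI, unfold prog_nth app_body_def, simp)
next
  case (Node x1 x2)
  show ?case
    by (rule computesI, unfold prog_nth app_body_def,
        (simp | rule wpc_computes[OF Node.IH(2)])+)
qed
lemmas [calls] = wpc_computes[OF app_computes]

lemma mem_computes:
  "x < K \<Longrightarrow> computes prog mem_fn [un x, enc_list un xs] (enc_bool (x \<in> set xs)) ((length xs + 1) * (40 * K))"
proof (induction xs)
  case Nil
  then show ?case by (intro computesI, unfold prog_nth mem_body_def) simp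
next
  case (Cons y ys)
  then show ?case
    by (intro computesI, unfold prog_nth mem_body_def)
       (simp | rule calls | rule wpc_computes[OF Cons.IH] | intro conjI impI)+
qed
lemmas [calls] = wpc_computes[OF mem_computes]

lemma remove_computes:
  "x < K \<Longrightarrow> computes prog remove_fn [un x, enc_list un xs] (enc_list un (filter (\<lambda>y. y \<noteq> x) xs))
    ((length xs + 1) * (40 * K))"
proof (induction xs arbitrary: x)
  case Nil
  then show ?case by (intro computesI, unfold prog_nth remove_body_def) simp
next
  case (Cons y ys)
  then show ?case
    by (intro computesI, unfold prog_nth remove_body_def)
       (simp | rule calls | rule wpc_computes[OF Cons.IH] | intro conjI impI)+
qed
lemmas [calls] = wpc_computes[OF remove_computes]

lemma map_cons_computes:
  "computes prog map_cons_fn [f x, enc_list (enc_list f) xss, enc_list (enc_list f) yss]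
    (enc_list (enc_list f) (map ((#) x) xss @ yss)) (20 * (length xss + 1))"
proof (induction xss)
  case Nil
  then show ?case by (intro computesI, unfold prog_nth map_cons_body_def) simp
next
  case (Cons y ys)
  then show ?case
    by (intro computesI, unfold prog_nth map_cons_body_def)
       (simp | rule calls | rule wpc_computes[OF Cons.IH] | intro conjI impI)+
qed
lemmas [calls] = wpc_computes[OF map_cons_computes]

lemma subseqs_computes:
  "computes prog subseqs_fn [enc_list f xs] (enc_list (enc_list f) (subseqs xs)) (120 * 2 ^ length xs)"
proof (induction xs)
  case Nil
  then show ?case by (intro computesI, unfold prog_nth subseqs_body_def) simp
next
  case (Cons y ys)
  \<comment> \<open>Makes positivity of the power visible to linear arithmetic: doubling the bound
    must also absorb a constant.\<close>
  obtain q where q: "(2::nat) ^ length ys = Suc q"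
    by (metis not0_implies_Suc power_not_zero zero_neq_numeral)
  show ?case
    by (intro computesI, unfold prog_nth subseqs_body_def)
       (simp add: length_subseqs Let_def q | rule calls | rule wpc_computes[OF Cons.IH] | intro conjI impI)+
qed
lemmas [calls] = wpc_computes[OF subseqs_computes]

lemma iota_computes:
  "computes prog iota_fn [enc_list f xs, un c] (enc_list un [c..<c + length xs]) (20 * (length xs + 1))"
proof (induction xs arbitrary: c)
  case Nil
  then show ?case by (intro computesI, unfold prog_nth iota_body_def) simp
next
  case (Cons y ys)
  have "[c..<c + length (y # ys)] = c # [Suc c..<Suc c + length ys]"
    by (simp add: upt_conv_Cons del: upt_Suc)
  then show ?case
    by (intro computesI, unfold prog_nth iota_body_def)
       (simp del: upt_Suc | rule calls | rule wpc_computes[OF Cons.IH[of "Suc c", unfolded un.simps]] | intro conjI impI)+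
qed
lemmas [calls] = wpc_computes[OF iota_computes]

fun rep_val :: "nat \<Rightarrow> val \<Rightarrow> val" where
  "rep_val 0 x = Leaf"
| "rep_val (Suc k) x = app_val x (rep_val k x)"

lemma spine_rep_val [simp]: "spine (rep_val k x) = k * spine x"
  by (induction k) auto

lemma rep_computes:
  "computes prog rep_fn [un k, x] (rep_val k x) ((k + 1) * (20 * (spine x + 2)))"
proof (induction k)
  case 0
  then show ?case by (intro computesI, unfold prog_nth rep_body_def) simp
next
  case (Suc k)
  then show ?case
    by (intro computesI, unfold prog_nth rep_body_def)
       (simp | rule calls | rule wpc_computes[OF Suc.IH] | intro conjI impI)+
qed
lemmas [calls] = wpc_computes[OF rep_computes]

lemma trunc_computes:
  "computes prog trunc_fn [un x, c] (un (min x (spine c))) (20 * (x + 1))"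
proof (induction x arbitrary: c)
  case 0
  then show ?case by (intro computesI, unfold prog_nth trunc_body_def) simp
next
  case (Suc x)
  then show ?case
    by (cases c; intro computesI, unfold prog_nth trunc_body_def)
       (simp | rule calls | rule wpc_computes[OF Suc.IH] | intro conjI impI)+
qed
lemmas [calls] = wpc_computes[OF trunc_computes]
text \<open>The form in which a successor appears during symbolic execution, when the bit is set and
  a \<open>Node\<close> was just put in front.\<close>

lemmas [calls] = wpc_computes[OF trunc_computes[of "Suc x" for x, unfolded un.simps]]

fun of_bits :: "bool list \<Rightarrow> nat" where
  "of_bits [] = 0"
| "of_bits (b # bs) = of_bool b + 2 * of_bits bs"

lemma of_bits_bits [simp]: "of_bits (bits n) = n"
proof (induction n rule: bits.induct)
  case (1 n)
  then show ?case by (subst bits.simps) (auto simp: odd_two_times_div_two_succ)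
qed

lemma unary_computes:
  "computes prog unary_fn [enc_list enc_bool bs, c] (un (min (of_bits bs) (spine c)))
    ((length bs + 1) * (60 * (spine c + 2)))"
proof (induction bs)
  case Nil
  then show ?case by (intro computesI, unfold prog_nth unary_body_def) simp
next
  case (Cons b bs)
  define r where "r = min (of_bits bs) (spine c)"
  \<comment> \<open>Cutting off before the doubling is harmless: a value at or above the cap stays
    so when doubled.\<close>
  have r: "min (r + r) (spine c) = min (2 * of_bits bs) (spine c)"
     "min (Suc (r + r)) (spine c) = min (Suc (2 * of_bits bs)) (spine c)"
     and le: "r \<le> spine c"
    unfolding r_def by auto
  show ?case
    apply (cases b; rule computesI, unfold prog_nth unary_body_def)
     apply (simp, rule wpc_computes[OF Cons.IH[folded r_def]], simp, rule calls, simp, rule calls, simp add: r)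
    using le
     apply linarith
     apply (simp, rule wpc_computes[OF Cons.IH[folded r_def]], simp, rule calls, simp, rule calls, simp add: r)
    using le
     apply linarith
    done
qed
lemmas [calls] = wpc_computes[OF unary_computes]

section \<open>Cost of the operations on the adjacency matrix\<close>

locale adjacency_matrix =
  fixes M :: "bool list list" and K :: nat
  assumes square: "r \<in> set M \<Longrightarrow> length r = length M"
  and K: "K = length M + 1"
begin

abbreviation "E u v \<equiv> M ! u ! v"
abbreviation "enc_M \<equiv> enc_list (enc_list enc_bool) M"

definition vlist :: "nat list \<Rightarrow> bool" where
  "vlist xs \<longleftrightarrow> set xs \<subseteq> {..<length M}"

lemma vlist_simps [simp]: "vlist []" "vlist (x # xs) \<longleftrightarrow> x < length M \<and> vlist xs"
  "vlist (xs @ ys) \<longleftrightarrow> vlist xs \<and> vlist ys"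
  by (auto simp: vlist_def)

lemma vlist_filter [simp]: "vlist xs \<Longrightarrow> vlist (filter P xs)"
  by (auto simp: vlist_def)

lemma row_computes: "u < length M \<Longrightarrow>
    computes prog nth_fn [enc_M, un u] (enc_list enc_bool (M ! u)) (20 * K)"
  using nth_computes[of u M "enc_list enc_bool"] by (rule computes_mono) (simp_all add: K)

lemma entry_computes: "u < length M \<Longrightarrow> v < length M \<Longrightarrow>
    computes prog nth_fn [enc_list enc_bool (M ! u), un v] (enc_bool (E u v)) (20 * K)"
  using nth_computes[of v "M ! u" enc_bool] by (rule computes_mono) (simp_all add: K square)

lemmas [calls] = wpc_computes[OF row_computes] wpc_computes[OF entry_computes]

lemma less_K [simp]: "u < length M \<Longrightarrow> u < K" by (simp add: K)

text \<open>Powers of \<open>K\<close> are kept folded so that all time bounds stay linear in them.\<close>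

definition "K2 = K * K"
definition "K3 = K2 * K"
definition "K4 = K3 * K"

lemma Kpow: "1 \<le> K" "K \<le> K2" "K2 \<le> K3" "K3 \<le> K4"
proof -
  show K1: "1 \<le> K" by (simp add: K)
  have "a \<le> a * K" for a using mult_le_mono2[OF K1, of a] by simp
  then show "K \<le> K2" "K2 \<le> K3" "K3 \<le> K4"
    unfolding K2_def K3_def K4_def by blast+
qed

lemma length_out_le: "length (out E V x) \<le> length V"
  by (induction V) (auto intro: le_SucI)

lemma Leaf_eq_enc_bool [simp]: "Leaf = enc_bool b \<longleftrightarrow> \<not> b"
  by (cases b) auto

text \<open>A loop over fewer than \<open>K\<close> elements raises the power of \<open>K\<close> by
  one and keeps the constant.\<close>

lemma loop_bound:
  assumes "length xs < K"
  shows "(length xs + 1) * (c * K) \<le> c * K2" "(length xs + 1) * (c * K2) \<le> c * K3"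
    "(length xs + 1) * (c * K3) \<le> c * K4"
proof -
  have "(length xs + 1) * (c * a) \<le> c * (a * K)" for a
    using mult_le_mono1[of "length xs + 1" K "c * a"] assms by (simp add: ac_simps)
  from this[of K] this[of K2] this[of K3] show
    "(length xs + 1) * (c * K) \<le> c * K2" "(length xs + 1) * (c * K2) \<le> c * K3"
    "(length xs + 1) * (c * K3) \<le> c * K4"
    unfolding K2_def K3_def K4_def by simp_all
qed

lemma nbrs_computes:
  "u < length M \<Longrightarrow> vlist V \<Longrightarrow> computes prog nbrs_fn [enc_M, un u, enc_list un V]
    (enc_list un (filter (E u) V)) ((length V + 1) * (80 * K))"
proof (induction V)
  case Nil
  then show ?case using Kpow by (intro computesI, unfold prog_nth nbrs_body_def) simp
next
  case (Cons y ys)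
  then have IH: "computes prog nbrs_fn [enc_M, un u, enc_list un ys]
    (enc_list un (filter (E u) ys)) ((length ys + 1) * (80 * K))" by simp
  show ?case using Cons.prems Kpow
    by (intro computesI, unfold prog_nth nbrs_body_def)
       (simp | rule wpc_computes[OF IH] | rule calls | intro conjI impI)+
qed
lemmas nbrs_computes' = computes_mono[OF nbrs_computes loop_bound(1)]
lemmas [calls] = wpc_computes[OF nbrs_computes']

lemma all_adj_computes:
  "u < length M \<Longrightarrow> vlist X \<Longrightarrow> computes prog all_adj_fn [enc_M, un u, enc_list un X]
    (enc_bool (\<forall>x\<in>set X. E u x)) ((length X + 1) * (80 * K))"
proof (induction X)
  case Nil
  then show ?case using Kpow by (intro computesI, unfold prog_nth all_adj_body_def) simp
next
  case (Cons y ys)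
  then have IH: "computes prog all_adj_fn [enc_M, un u, enc_list un ys]
    (enc_bool (\<forall>x\<in>set ys. E u x)) ((length ys + 1) * (80 * K))" by simp
  show ?case using Cons.prems Kpow
    by (intro computesI, unfold prog_nth all_adj_body_def)
       (simp | rule wpc_computes[OF IH] | rule calls | intro conjI impI)+
qed

lemmas all_adj_computes' = computes_mono[OF all_adj_computes loop_bound(1)]
lemmas [calls] = wpc_computes[OF all_adj_computes']

lemmas mem_computes' = computes_mono[OF mem_computes loop_bound(1)]
lemmas remove_computes' = computes_mono[OF remove_computes loop_bound(1)]
text \<open>Bounds that mention list lengths give way to bounds in the folded powers of
  \<open>K\<close>, keeping the arithmetic of the callers linear.\<close>

lemmas [calls del] = wpc_computes[OF mem_computes] wpc_computes[OF remove_computes]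
lemmas [calls] = wpc_computes[OF mem_computes'] wpc_computes[OF remove_computes']

lemma eq_computes': "x < length M \<Longrightarrow> computes prog eq_fn [un x, un y] (enc_bool (x = y)) (20 * K)"
  by (rule computes_mono[OF eq_computes]) (simp add: K)
lemmas [calls del] = wpc_computes[OF eq_computes]
lemmas [calls] = wpc_computes[OF eq_computes']

lemma leq_computes':
  "length xs < K \<Longrightarrow>
    computes prog leq_fn [enc_list f xs, enc_list g ys] (enc_bool (length xs \<le> length ys)) (20 * K)"
  by (rule computes_mono[OF leq_computes[of "enc_list f xs" "enc_list g ys", simplified]]) simp

lemma length_filter_K [simp]: "length xs < K \<Longrightarrow> length (filter P xs) < K"
  using length_filter_le le_less_trans by blast

lemma common_computes:
  "vlist V \<Longrightarrow> vlist X \<Longrightarrow> length X < K \<Longrightarrow> computes prog common_fn [enc_M, enc_list un X, enc_list un V]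
    (enc_list un (common E X V)) ((length V + 1) * (120 * K2))"
proof (induction V)
  case Nil
  then show ?case using Kpow by (intro computesI, unfold prog_nth common_body_def) (simp add: common_def)
next
  case (Cons y ys)
  have IH: "computes prog common_fn [enc_M, enc_list un X, enc_list un ys]
    (enc_list un (common E X ys)) ((length ys + 1) * (120 * K2))" using Cons by simp
  show ?case using Cons.prems Kpow 
    by (intro computesI, unfold prog_nth common_body_def)
       (simp add: common_def | rule wpc_computes[OF IH] | rule wpc_computes[OF leq_computes'] | rule calls | intro conjI impI)+
qed
lemmas common_computes' = computes_mono[OF common_computes loop_bound(2)]
lemmas [calls] = wpc_computes[OF common_computes']

lemma subset_computes:
  "vlist X \<Longrightarrow> length U < K \<Longrightarrow> computes prog subset_fn [enc_list un X, enc_list un U]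
    (enc_bool (set X \<subseteq> set U)) ((length X + 1) * (60 * K2))"
proof (induction X)
  case Nil
  then show ?case using Kpow by (intro computesI, unfold prog_nth subset_body_def) (simp )
next
  case (Cons y ys)
  have IH: "computes prog subset_fn [enc_list un ys, enc_list un U]
    (enc_bool (set ys \<subseteq> set U)) ((length ys + 1) * (60 * K2))" using Cons by simp
  show ?case using Cons.prems Kpow 
    by (intro computesI, unfold prog_nth subset_body_def)
       (simp  | rule wpc_computes[OF IH] | rule wpc_computes[OF leq_computes'] | rule calls | intro conjI impI)+
qed
lemmas subset_computes' = computes_mono[OF subset_computes loop_bound(2)]
lemmas [calls] = wpc_computes[OF subset_computes']

lemma viol_computes:
  "length X < K \<Longrightarrow> i \<le> K \<Longrightarrow> j \<le> K \<Longrightarrow>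
   computes prog viol_fn [un i, un j, enc_list un X, enc_list un C]
    (enc_bool (length X = i \<and> j \<le> length C)) (150 * K)"
  using Kpow
  by (intro computesI, unfold prog_nth viol_body_def)
     (simp | rule calls | intro conjI impI)+
lemmas [calls] = wpc_computes[OF viol_computes]

lemma good_computes:
  "vlist V \<Longrightarrow> vlist X \<Longrightarrow> length X < K \<Longrightarrow> length V < K \<Longrightarrow> length U < K \<Longrightarrow> i \<le> K \<Longrightarrow> j \<le> K \<Longrightarrow>
   computes prog good_fn [enc_M, un i, un j, enc_list un V, enc_list un U, enc_bool fl, enc_list un X]
    (enc_bool (viol E i j V X \<and> (fl \<or> \<not> set X \<subseteq> set U))) (600 * K3)"
  using Kpow
  by (intro computesI, unfold prog_nth good_body_def)
     (simp add: viol_def | rule calls | intro conjI impI)+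
lemmas [calls] = wpc_computes[OF good_computes]

fun enc_option :: "nat list option \<Rightarrow> val" where
  "enc_option None = Leaf"
| "enc_option (Some X) = Node (enc_list un X) Leaf"

lemma enc_option_eq_Leaf [simp]: "enc_option x = Leaf \<longleftrightarrow> x = None"
  by (cases x) auto

lemma find_computes:
  "vlist V \<Longrightarrow> length V < K \<Longrightarrow> length U < K \<Longrightarrow> i \<le> K \<Longrightarrow> j \<le> K \<Longrightarrow>
    (\<And>X. X \<in> set cs \<Longrightarrow> vlist X \<and> length X < K) \<Longrightarrow>
   computes prog find_fn
     [enc_M, un i, un j, enc_list un V, enc_list un U, enc_bool fl, enc_list (enc_list un) cs]
    (enc_option (find (\<lambda>X. viol E i j V X \<and> (fl \<or> \<not> set X \<subseteq> set U)) cs))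
    ((length cs + 1) * (700 * K3))"
proof (induction cs)
  case Nil
  then show ?case using Kpow by (intro computesI, unfold prog_nth find_body_def) simp
next
  case (Cons Y cs)
  from Cons have IH: "computes prog find_fn
     [enc_M, un i, un j, enc_list un V, enc_list un U, enc_bool fl, enc_list (enc_list un) cs]
    (enc_option (find (\<lambda>X. viol E i j V X \<and> (fl \<or> \<not> set X \<subseteq> set U)) cs))
    ((length cs + 1) * (700 * K3))" by simp
  show ?case using Cons.prems Kpow
    by (intro computesI, unfold prog_nth find_body_def)
       (simp | rule wpc_computes[OF IH] | rule wpc_computes[OF leq_computes'] | rule calls | intro conjI impI)+
qed
lemmas [calls] = wpc_computes[OF find_computes]

lemma out_computes:
  "vlist V \<Longrightarrow> x < length M \<Longrightarrow> length V < K \<Longrightarrow> computes prog out_fn [enc_M, enc_list un V, un x]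
    (enc_list un (out E V x)) ((length V + 1) * (120 * K2))"
proof (induction V)
  case Nil
  then show ?case using Kpow by (intro computesI, unfold prog_nth out_body_def) (simp )
next
  case (Cons y ys)
  have IH: "computes prog out_fn [enc_M, enc_list un ys, un x]
    (enc_list un (out E ys x)) ((length ys + 1) * (120 * K2))" using Cons by simp
  show ?case using Cons.prems Kpow 
    by (intro computesI, unfold prog_nth out_body_def)
       (simp  | rule wpc_computes[OF IH] | rule wpc_computes[OF leq_computes'] | rule calls | intro conjI impI)+
qed
lemmas out_computes' = computes_mono[OF out_computes loop_bound(2)]
lemmas [calls] = wpc_computes[OF out_computes']

lemma outs_computes:
  "vlist X \<Longrightarrow> vlist V \<Longrightarrow> length V < K \<Longrightarrow> computes prog outs_fn [enc_M, enc_list un V, enc_list un X]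
    (enc_list un (concat (map (out E V) X))) ((length X + 1) * (200 * K3))"
proof (induction X)
  case Nil
  then show ?case using Kpow by (intro computesI, unfold prog_nth outs_body_def) (simp )
next
  case (Cons y ys)
  have IH: "computes prog outs_fn [enc_M, enc_list un V, enc_list un ys]
    (enc_list un (concat (map (out E V) ys))) ((length ys + 1) * (200 * K3))" using Cons by simp
  show ?case using Cons.prems Kpow length_out_le[of V y]
    by (intro computesI, unfold prog_nth outs_body_def)
       (simp  | rule wpc_computes[OF IH] | rule wpc_computes[OF leq_computes'] | rule calls | intro conjI impI)+
qed
lemmas outs_computes' = computes_mono[OF outs_computes loop_bound(3)]
lemmas [calls] = wpc_computes[OF outs_computes']

lemma same_type_computes:
  "vlist U \<Longrightarrow> b < length M \<Longrightarrow> c < length M \<Longrightarrow> computes prog same_type_fn [enc_M, un b, un c, enc_list un U]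
    (enc_bool (same_type E U b c)) ((length U + 1) * (120 * K))"
proof (induction U)
  case Nil
  then show ?case using Kpow by (intro computesI, unfold prog_nth same_type_body_def) (simp add: same_type_def)
next
  case (Cons y ys)
  have IH: "computes prog same_type_fn [enc_M, un b, un c, enc_list un ys]
    (enc_bool (same_type E ys b c)) ((length ys + 1) * (120 * K))" using Cons by simp
  show ?case using Cons.prems Kpow 
    by (intro computesI, unfold prog_nth same_type_body_def)
       (simp add: same_type_def | rule wpc_computes[OF IH] | rule wpc_computes[OF leq_computes'] | rule calls | intro conjI impI)+
qed
lemmas same_type_computes' = computes_mono[OF same_type_computes loop_bound(1)]
lemmas [calls] = wpc_computes[OF same_type_computes']

lemma has_type_computes:
  "vlist V \<Longrightarrow> b < length M \<Longrightarrow> vlist U \<Longrightarrow> length U < K \<Longrightarrow> computes prog has_type_fn [enc_M, enc_list un U, un b, enc_list un V]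
    (enc_bool (\<exists>c\<in>set V. same_type E U b c)) ((length V + 1) * (150 * K2))"
proof (induction V)
  case Nil
  then show ?case using Kpow by (intro computesI, unfold prog_nth has_type_body_def) (simp )
next
  case (Cons y ys)
  have IH: "computes prog has_type_fn [enc_M, enc_list un U, un b, enc_list un ys]
    (enc_bool (\<exists>c\<in>set ys. same_type E U b c)) ((length ys + 1) * (150 * K2))" using Cons by simp
  show ?case using Cons.prems Kpow 
    by (intro computesI, unfold prog_nth has_type_body_def)
       (simp  | rule wpc_computes[OF IH] | rule wpc_computes[OF leq_computes'] | rule calls | intro conjI impI)+
qed
lemmas has_type_computes' = computes_mono[OF has_type_computes loop_bound(2)]
lemmas [calls] = wpc_computes[OF has_type_computes']

lemma reps_computes:
  "vlist V \<Longrightarrow> vlist U \<Longrightarrow> length U < K \<Longrightarrow> length V < K \<Longrightarrow> computes prog reps_fn [enc_M, enc_list un U, enc_list un V]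
    (enc_list un (reps E U V)) ((length V + 1) * (200 * K3))"
proof (induction V)
  case Nil
  then show ?case using Kpow by (intro computesI, unfold prog_nth reps_body_def) (simp )
next
  case (Cons y ys)
  have IH: "computes prog reps_fn [enc_M, enc_list un U, enc_list un ys]
    (enc_list un (reps E U ys)) ((length ys + 1) * (200 * K3))" using Cons by simp
  show ?case using Cons.prems Kpow 
    by (intro computesI, unfold prog_nth reps_body_def)
       (simp  | rule wpc_computes[OF IH] | rule wpc_computes[OF leq_computes'] | rule calls | intro conjI impI)+
qed
lemmas reps_computes' = computes_mono[OF reps_computes loop_bound(3)]
lemmas [calls] = wpc_computes[OF reps_computes']

lemma argmin_computes:
  "vlist vs \<Longrightarrow> vlist V \<Longrightarrow> length V < K \<Longrightarrow> b < length M \<Longrightarrow> computes prog argmin_fn [enc_M, enc_list un V, un b, enc_list un vs]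
    (un (argmin E V b vs)) ((length vs + 1) * (250 * K2))"
proof (induction vs arbitrary: b)
  case Nil
  then show ?case using Kpow by (intro computesI, unfold prog_nth argmin_body_def) (simp )
next
  case (Cons y ys)
  have IH: "computes prog argmin_fn [enc_M, enc_list un V, un b, enc_list un ys]
    (un (argmin E V b ys)) ((length ys + 1) * (250 * K2))" if "b < length M" for b using Cons that by simp
  show ?case using Cons.prems Kpow 
    by (intro computesI, unfold prog_nth argmin_body_def)
       (simp  | rule wpc_computes[OF IH] | rule wpc_computes[OF leq_computes'] | rule calls | intro conjI impI)+
qed
lemmas argmin_computes' = computes_mono[OF argmin_computes loop_bound(2)]
lemmas [calls] = wpc_computes[OF argmin_computes']

lemma max_out_computes:
  "vlist V \<Longrightarrow> length V < K \<Longrightarrow> computes prog max_out_fn [enc_M, enc_list un V]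
    (enc_list un (max_out E V)) ((length V + 1) * (150 * K2))"
proof (induction V)
  case Nil
  then show ?case using Kpow by (intro computesI, unfold prog_nth max_out_body_def) (simp )
next
  case (Cons y ys)
  have IH: "computes prog max_out_fn [enc_M, enc_list un ys]
    (enc_list un (max_out E ys)) ((length ys + 1) * (150 * K2))" using Cons by simp
  show ?case using Cons.prems Kpow 
    by (intro computesI, unfold prog_nth max_out_body_def)
       (simp  | rule wpc_computes[OF IH] | rule wpc_computes[OF leq_computes'] | rule calls | intro conjI impI)+
qed
lemmas max_out_computes' = computes_mono[OF max_out_computes loop_bound(2)]
lemmas [calls] = wpc_computes[OF max_out_computes']

end

text \<open>
  A bound for the number of calls made by \<^const>\<open>solve\<close> when \<open>k\<close> deletions are left, \<open>r = L - |U|\<close>,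
  and every call tries at most \<open>B\<close> vertices for deletion.
\<close>

definition nodes :: "nat \<Rightarrow> nat \<Rightarrow> nat \<Rightarrow> nat \<Rightarrow> nat" where
  "nodes L B k r = (r + 1) * (k + 1) * ((L + 1) * B) ^ k"

lemma nodes_pos: "1 \<le> B \<Longrightarrow> 1 \<le> nodes L B k r"
  unfolding nodes_def by (metis One_nat_def Suc_leI mult_pos_pos zero_less_power Suc_eq_plus1 less_eq_Suc_le zero_less_Suc)

lemma nodes_mono: "r \<le> s \<Longrightarrow> nodes L B k r \<le> nodes L B k s"
  unfolding nodes_def by (intro mult_le_mono) auto

text \<open>The recurrence for deletions. The unspent budget \<open>r\<close> of a child may be as
  large as \<open>L\<close>, hence a factor \<open>L + 1\<close> per level; the step from
  \<open>k + 1\<close> to \<open>k + 2\<close> in the linear factor pays for the call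
  itself.\<close>

lemma nodes_children:
  assumes "1 \<le> B" "r \<le> L"
  shows "1 + B * nodes L B k r \<le> nodes L B (Suc k) 0"
proof -
  define q where "q = ((L + 1) * B) ^ k"
  have q: "1 \<le> q" using assms(1) by (simp add: q_def)
  have "1 * 1 \<le> B * q" using q assms(1) by (intro mult_le_mono)
  then have Bq: "1 \<le> (L + 1) * B * q" by (simp add: mult.assoc)
  have "B * nodes L B k r = (k + 1) * ((r + 1) * B * q)" by (simp only: nodes_def q_def mult_ac)
  also have "\<dots> \<le> (k + 1) * ((L + 1) * B * q)" using assms(2) by (intro mult_le_mono) auto
  finally have "1 + B * nodes L B k r \<le> (L + 1) * B * q + (k + 1) * ((L + 1) * B * q)"
    using Bq by (rule add_mono[rotated])
  also have "\<dots> = (Suc k + 1) * ((L + 1) * B * q)" by (simp only: Suc_eq_plus1 distrib_right mult_1)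
  also have "\<dots> = nodes L B (Suc k) 0" by (simp add: nodes_def q_def)
  finally show ?thesis .
qed

text \<open>The recurrence for enlarging \<open>U\<close>: one share \<open>nodes L B k 0\<close>
  covers the call with its deletions, the rest covers the call with the larger
  \<open>U\<close>.\<close>

lemma nodes_Suc_budget: "nodes L B k 0 + nodes L B k r = nodes L B k (Suc r)"
  by (simp add: nodes_def algebra_simps)

section \<open>Cost of the candidate lists, the ordering and the recursive search\<close>

context adjacency_matrix begin

lemma cands_computes:
  "vlist V \<Longrightarrow> length V < K \<Longrightarrow> length (max_out E V) \<le> d \<Longrightarrow>
    computes prog cands_fn [enc_M, enc_list un V] (enc_list (enc_list un) (cands E V))
      ((length V + 1) * (300 * (K2 * 2 ^ d)))"
proof (induction V)
  case Nil
  have "1 \<le> K2 * 2 ^ d" using Kpow by (simp add: Suc_le_eq)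
  then have "Suc (Suc (Suc (Suc (Suc 0)))) \<le> 300 * (K2 * 2 ^ d)" by linarith
  then show ?case
    by (intro computesI, unfold prog_nth cands_body_def) simp
next
  case (Cons v vs)
  let ?n = "length (filter (E v) vs)"
  have IH: "computes prog cands_fn [enc_M, enc_list un vs] (enc_list (enc_list un) (cands E vs))
      ((length vs + 1) * (300 * (K2 * 2 ^ d)))"
    using Cons by (auto simp del: max_out.simps)
  define Z where "Z = K2 * 2 ^ d"
  define p :: nat where "p = 2 ^ ?n"
  have p: "p \<le> 2 ^ d"
    using Cons.prems unfolding p_def by (intro power_increasing) (auto simp del: max_out.simps)
  have "1 \<le> K2" using Kpow by linarith
  then have Z: "1 \<le> Z" "2 ^ d \<le> Z" "K2 \<le> Z" using Kpow by (auto simp: Z_def Suc_le_eq)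
  then have pZ: "p \<le> Z" using p by linarith
  show ?case using Cons.prems(1,2) Z(1,3) pZ
    by (intro computesI, unfold prog_nth cands_body_def)
       (simp add: length_subseqs p_def[symmetric] Z_def[symmetric] | rule wpc_computes[OF IH] | rule calls | intro conjI impI
        )+
qed

lemma distinct_less_K: "distinct V \<Longrightarrow> vlist V \<Longrightarrow> length V < K"
  unfolding vlist_def K using card_mono[of "{..<length M}" "set V"] by (simp add: distinct_card)

lemma union_computes:
  "vlist X \<Longrightarrow> vlist U \<Longrightarrow> distinct U \<Longrightarrow>
    computes prog union_fn [enc_list un X, enc_list un U] (enc_list un (List.union X U))
      ((length X + 1) * (60 * K2))"
proof (induction X arbitrary: U)
  case Nil
  then show ?case using Kpow by (intro computesI, unfold prog_nth union_body_def) (simp add: List.union_def)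
next
  case (Cons x X)
  have IH1: "computes prog union_fn [enc_list un X, enc_list un U] (enc_list un (List.union X U))
      ((length X + 1) * (60 * K2))" using Cons by simp
  have IH2: "computes prog union_fn [enc_list un X, Node (un x) (enc_list un U)] (enc_list un (List.union X (x # U)))
      ((length X + 1) * (60 * K2))" if "x \<notin> set U" using Cons.IH[of "x # U"] Cons.prems that by simp
  show ?case using Cons.prems Kpow distinct_less_K[OF Cons.prems(3,2)]
    by (intro computesI, unfold prog_nth union_body_def)
       (simp add: List.union_def List.insert_def | rule wpc_computes[OF IH1] wpc_computes[OF IH2] | rule calls | intro conjI impI)+
qed

text \<open>The time \<open>B\<close> of the calls to \<open>solve\<close> is assumed, which breaks
  the mutual recursion: in \<open>solve_computes\<close> the assumption is an induction
  hypothesis.\<close>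

lemma any_computes:
  assumes V: "vlist V" "length V < K"
    and c: "\<And>c. c \<in> set C \<Longrightarrow> c < length M \<and> computes prog solve_fn
      [enc_M, un i, un j, lv, enc_list un (filter (\<lambda>y. y \<noteq> c) V), enc_list un U, un k] (enc_bool (g c)) B"
  shows "computes prog any_fn [enc_M, un i, un j, lv, enc_list un V, enc_list un U, un k, enc_list un C]
    (enc_bool (list_ex g C)) (length C * (B + 100 * K2) + 10)"
  using c
proof (induction C)
  case Nil
  then show ?case using Kpow by (intro computesI, unfold prog_nth any_body_def) simp
next
  case (Cons c C)
  have IH: "computes prog any_fn [enc_M, un i, un j, lv, enc_list un V, enc_list un U, un k, enc_list un C]
    (enc_bool (list_ex g C)) (length C * (B + 100 * K2) + 10)" using Cons by simp
  have c: "c < length M" and s: "computes prog solve_fn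
      [enc_M, un i, un j, lv, enc_list un (filter (\<lambda>y. y \<noteq> c) V), enc_list un U, un k] (enc_bool (g c)) B"
    using Cons.prems[of c] by auto
  show ?case using V Kpow c
    by (intro computesI, unfold prog_nth any_body_def)
       (simp | rule wpc_computes[OF IH] | rule wpc_computes[OF s] | rule calls | intro conjI impI)+
qed

lemma order_computes:
  "vlist V \<Longrightarrow> length V < K \<Longrightarrow> computes prog order_fn [enc_M, enc_list un V] (enc_list un (elim_order E V))
    ((length V + 1) * (400 * K3))"
proof (induction V rule: length_induct)
  case (1 V)
  show ?case
  proof (cases V)
    case Nil
    then show ?thesis using Kpow by (intro computesI, unfold prog_nth order_body_def) simp
  next
    case (Cons v vs)
    define b where "b = argmin E V v vs"
    define V' where "V' = filter (\<lambda>x. x \<noteq> b) V"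
    have b: "b \<in> set V" using argmin_in[of E V v vs] Cons by (simp add: b_def)
    then have len: "length V' < length V" unfolding V'_def by (intro length_filter_less[of b]) auto
    have "computes prog order_fn [enc_M, enc_list un V'] (enc_list un (elim_order E V')) ((length V' + 1) * (400 * K3))"
      using 1 len by (auto simp: V'_def)
    then have IH: "computes prog order_fn [enc_M, enc_list un V'] (enc_list un (elim_order E V')) (length V * (400 * K3))"
      by (rule computes_mono) (use len in \<open>intro mult_le_mono, auto\<close>)
    have am: "computes prog argmin_fn [enc_M, enc_list un V, un v, enc_list un vs] (un b) (250 * K3)"
      unfolding b_def using 1(2,3) Cons by (intro argmin_computes') auto
    have rm: "computes prog remove_fn [un b, enc_list un V] (enc_list un V') (40 * K2)"
      unfolding V'_def using 1(2,3) b by (intro remove_computes') (auto simp: vlist_def)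
    have o: "elim_order E V = b # elim_order E V'" by (simp add: Cons b_def V'_def Let_def)
    have ne: "V \<noteq> []" "fst_val (enc_list un V) = un v" "snd_val (enc_list un V) = enc_list un vs"
      using Cons by auto
    show ?thesis using Kpow
      by (intro computesI, unfold prog_nth order_body_def)
         (simp add: ne o | rule wpc_computes[OF am] wpc_computes[OF rm] wpc_computes[OF IH])+
  qed
qed

end

context adjacency_matrix begin

lemma solve_computes:
  fixes i j d B L :: nat and lv :: val
  assumes ij: "i \<le> K" "j \<le> K" and B: "d + d * d \<le> B" "2 ^ L \<le> B" and L: "spine lv = L"
  defines "Z \<equiv> K4 * 2 ^ d"
  defines "W \<equiv> 5000 * Z"
  assumes "vlist V" "distinct V" "vlist U" "distinct U" "length U \<le> L" "length (max_out E V) \<le> d"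
  shows "\<exists>T. T + W \<le> 2 * W * nodes L B k (L - length U) \<and>
    computes prog solve_fn [enc_M, un i, un j, lv, enc_list un V, enc_list un U, un k]
      (enc_bool (solve E i j L V U k)) T"
  using assms(8-)
proof (induction k arbitrary: V U rule: less_induct)
  case (less k)
  note IHk = less.IH
  from less.prems(3-5) show ?case
  proof (induction "L - length U" arbitrary: U rule: less_induct)
    case (less U)
    note IHr = less.hyps
    note V = \<open>vlist V\<close> \<open>distinct V\<close> and U = less.prems and dV = \<open>length (max_out E V) \<le> d\<close>
    define r where "r = L - length U"
    define cs where "cs = cands E V"
    define f where "f = find (\<lambda>X. viol E i j V X \<and> \<not> set X \<subseteq> set U) cs"
    define rec where "rec = (\<lambda>c. solve E i j L (filter (\<lambda>y. y \<noteq> c) V) U (k - 1))"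
    define N where "N = 2 * W * nodes L B k 0"
    have lenV: "length V < K" and lenU: "length U < K"
      using V U by (auto intro: distinct_less_K)
    have B1: "1 \<le> B" using B(2) by (metis one_le_numeral one_le_power order_trans)
    have Z: "1 \<le> Z" "K4 \<le> Z" using Kpow by (auto simp: Z_def Suc_le_eq)
    have step: "(length V + 1) * (c * (K2 * 2 ^ d)) \<le> c * Z" for c
    proof -
      have "(length V + 1) * (c * (K2 * 2 ^ d)) = ((length V + 1) * (c * K2)) * 2 ^ d" by (simp only: mult.assoc)
      also have "\<dots> \<le> (c * K3) * 2 ^ d" using loop_bound(2)[OF lenV] by (rule mult_le_mono1)
      also have "\<dots> \<le> (c * K4) * 2 ^ d" using Kpow by simp
      finally show ?thesis by (simp add: Z_def)
    qed
    have len_cs: "length cs \<le> K * 2 ^ d"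
    proof -
      have "length cs \<le> (length V + 1) * 2 ^ length (max_out E V)"
        unfolding cs_def by (rule length_cands)
      also have "\<dots> \<le> K * 2 ^ d" using lenV dV by (intro mult_le_mono power_increasing) auto
      finally show ?thesis .
    qed
    have "1 * 1 \<le> K * 2 ^ d" using Kpow by (intro mult_le_mono) auto
    then have "length cs + 1 \<le> 2 * (K * 2 ^ d)" using len_cs by linarith
    then have "(length cs + 1) * (700 * K3) \<le> 2 * (K * 2 ^ d) * (700 * K3)" by (rule mult_le_mono1)
    then have len_cs': "(length cs + 1) * (700 * K3) \<le> 1400 * Z" by (simp add: Z_def K4_def ac_simps)
    have cs_ok: "vlist X \<and> length X < K \<and> length X \<le> d" if "X \<in> set cs" for X
      using cands_props[OF that[unfolded cs_def]] V dV length_max_out[of E V] lenV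
      by (auto simp: vlist_def)
    have cnd: "computes prog cands_fn [enc_M, enc_list un V] (enc_list (enc_list un) cs) (300 * Z)"
      unfolding cs_def by (rule computes_mono[OF cands_computes[OF V(1) lenV dV] step])
    have f1: "computes prog find_fn
        [enc_M, un i, un j, enc_list un V, enc_list un U, Leaf, enc_list (enc_list un) cs]
        (enc_option f) (1400 * Z)"
      using computes_mono[OF find_computes[OF V(1) lenV lenU ij, of cs False] len_cs'] cs_ok
      unfolding f_def by simp
    have f2: "computes prog find_fn
        [enc_M, un i, un j, enc_list un V, enc_list un U, Node Leaf Leaf, enc_list (enc_list un) cs]
        (enc_option (find (viol E i j V) cs)) (1400 * Z)"
      using computes_mono[OF find_computes[OF V(1) lenV lenU ij, of cs True] len_cs'] cs_ok
      by simp
    \<comment> \<open>Shared by both deletion branches; \<open>A\<close> is the total charge for the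
      children. For \<open>k = 0\<close> there are none, but the inequality is still needed.\<close>
    have anyc: "\<exists>A. 2 * W + A \<le> N \<and> (k \<noteq> 0 \<longrightarrow> computes prog any_fn
          [enc_M, un i, un j, lv, enc_list un V, enc_list un U, un (k - 1), enc_list un C]
          (enc_bool (list_ex rec C)) (A + 10))"
      if C: "set C \<subseteq> set V" "length C \<le> B" for C
    proof (cases k)
      case 0
      have "2 * W * 1 \<le> N" unfolding N_def by (intro mult_le_mono2 nodes_pos B1)
      with 0 show ?thesis by (intro exI[of _ 0]) simp
    next
      case (Suc k')
      define X where "X = 2 * W * nodes L B k' r"
      \<comment> \<open>Ensures that \<open>X - W\<close> is a genuine difference.\<close>
      have "2 * W * 1 \<le> X" unfolding X_def by (intro mult_le_mono2 nodes_pos B1)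
      then have X: "X - W + W = X" by simp
      have child: "c < length M \<and> computes prog solve_fn
          [enc_M, un i, un j, lv, enc_list un (filter (\<lambda>y. y \<noteq> c) V), enc_list un U, un k']
          (enc_bool (rec c)) (X - W)" if "c \<in> set C" for c
      proof -
        have "length (max_out E (filter (\<lambda>y. y \<noteq> c) V)) \<le> d"
          using max_out_filter dV order_trans by blast
        then obtain T where "T + W \<le> X" "computes prog solve_fn
          [enc_M, un i, un j, lv, enc_list un (filter (\<lambda>y. y \<noteq> c) V), enc_list un U, un k']
          (enc_bool (rec c)) T"
          using IHk[of k' "filter (\<lambda>y. y \<noteq> c) V" U] V U Suc unfolding X_def r_def rec_def by auto
        then have "computes prog solve_fn
          [enc_M, un i, un j, lv, enc_list un (filter (\<lambda>y. y \<noteq> c) V), enc_list un U, un k']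
          (enc_bool (rec c)) (X - W)"
          by (intro computes_mono[of _ _ _ _ T "X - W"]) auto
        with C(1) that V(1) show ?thesis by (auto simp: vlist_def)
      qed
      \<comment> \<open>The \<open>W\<close> left over by each child pays for removing the vertex
        and advancing the loop.\<close>
      have le: "length C * (X - W + 100 * K2) + 10 \<le> B * X + 10"
      proof -
        have "100 * K2 \<le> W" using Kpow Z unfolding W_def by linarith
        then have "X - W + 100 * K2 \<le> X" using X by linarith
        then show ?thesis using C(2) by (intro add_mono mult_le_mono) auto
      qed
      have any: "computes prog any_fn
          [enc_M, un i, un j, lv, enc_list un V, enc_list un U, un k', enc_list un C]
          (enc_bool (list_ex rec C)) (B * X + 10)"
        by (rule computes_mono[OF any_computes[OF V(1) lenV child] le])
      have "2 * W + B * X = 2 * W * (1 + B * nodes L B k' r)"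
        by (simp add: X_def algebra_simps)
      also have "\<dots> \<le> N"
        unfolding N_def Suc by (intro mult_le_mono2 nodes_children B1) (simp add: r_def)
      finally show ?thesis using any Suc by (intro exI[of _ "B * X"]) simp
    qed
    have N_le: "N \<le> 2 * W * nodes L B k r"
      unfolding N_def by (intro mult_le_mono2 nodes_mono) simp
    have big: "6 + K \<le> 100 * Z" "40 \<le> 100 * Z" "K2 \<le> Z" "K3 \<le> Z" "K \<le> Z"
      using Kpow Z by linarith+
    show ?case
    proof (cases f)
      case None
      have r: "computes prog reps_fn [enc_M, enc_list un U, enc_list un V] (enc_list un (reps E U V)) (200 * K4)"
        using V U lenV lenU by (intro reps_computes') auto
      have "length (reps E U V) \<le> B"
        using length_reps[of E U V] B(2)
        by (meson U(3) one_le_numeral order_trans power_increasing)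
      from anyc[OF set_reps this] obtain A where A: "2 * W + A \<le> N"
        and any: "k \<noteq> 0 \<Longrightarrow> computes prog any_fn
          [enc_M, un i, un j, lv, enc_list un V, enc_list un U, un (k - 1), enc_list un (reps E U V)]
          (enc_bool (list_ex rec (reps E U V))) (A + 10)" by blast
      have s: "solve E i j L V U k = (find (viol E i j V) cs = None \<or> k \<noteq> 0 \<and> list_ex rec (reps E U V))"
        by (subst solve.simps) (use None in \<open>auto simp: f_def cs_def rec_def\<close>)
      have snd: "snd_val (un k) = un (k - 1)" by (cases k) auto
      have "computes prog solve_fn [enc_M, un i, un j, lv, enc_list un V, enc_list un U, un k]
        (enc_bool (solve E i j L V U k)) (4000 * Z + A)"
        unfolding s using big Z
        by (intro computesI, unfold prog_nth solve_body_def)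
           (simp add: None snd del: not_None_eq
            | rule wpc_computes[OF cnd] wpc_computes[OF f1] wpc_computes[OF f2] wpc_computes[OF r] wpc_computes[OF any[unfolded One_nat_def]]
            | intro conjI impI)+
      moreover have "4000 * Z + A + W \<le> 2 * W * nodes L B k r"
        using A N_le Z unfolding W_def by linarith
      ultimately show ?thesis unfolding r_def by blast
    next
      case (Some X)
      then have X: "X \<in> set cs" and XU: "\<not> set X \<subseteq> set U"
        unfolding f_def by (auto simp: find_Some_iff)
      note Xok = cs_ok[OF X]
      define C where "C = X @ concat (map (out E V) X)"
      define U' where "U' = List.union X U"
      have os: "computes prog outs_fn [enc_M, enc_list un V, enc_list un X]
          (enc_list un (concat (map (out E V) X))) (200 * K4)"
        using V lenV Xok by (intro outs_computes') auto
      have un: "computes prog union_fn [enc_list un X, enc_list un U] (enc_list un U') (60 * K3)"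
        unfolding U'_def using computes_mono[OF union_computes loop_bound(2)] Xok U by blast
      have U': "vlist U'" "distinct U'" using Xok U unfolding U'_def by (auto simp: vlist_def)
      have lq: "computes prog leq_fn [enc_list un U', lv] (enc_bool (length U' \<le> L)) (20 * K)"
        using computes_mono[OF leq_computes[of "enc_list un U'" lv]] distinct_less_K[OF U'(2,1)] L by simp
      have setC: "set C \<subseteq> set V"
        using cands_props(1)[OF X[unfolded cs_def]] set_out unfolding C_def by fastforce
      have "length (concat (map (out E V) X)) \<le> d * d"
      proof -
        have "length (concat (map (out E V) X)) \<le> length X * d"
          using dV length_out[of E V] by (induction X) (auto intro: add_mono order_trans)
        also have "\<dots> \<le> d * d" using Xok by simp
        finally show ?thesis .
      qed
      then have "length C \<le> B" using Xok B(1) unfolding C_def by simp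
      from anyc[OF setC this] obtain A where A: "2 * W + A \<le> N"
        and any: "k \<noteq> 0 \<Longrightarrow> computes prog any_fn
          [enc_M, un i, un j, lv, enc_list un V, enc_list un U, un (k - 1), enc_list un C]
          (enc_bool (list_ex rec C)) (A + 10)" by blast
      \<comment> \<open>If the enlarged \<open>U\<close> exceeds \<open>L\<close>, no call follows
        and \<open>T = 0\<close> is charged.\<close>
      have "\<exists>T. 2 * W + A + T \<le> 2 * W * nodes L B k r \<and> (length U' \<le> L \<longrightarrow>
          computes prog solve_fn [enc_M, un i, un j, lv, enc_list un V, enc_list un U', un k]
            (enc_bool (solve E i j L V U' k)) T)"
      proof (cases "length U' \<le> L")
        case True
        have lt: "L - length U' < L - length U"
          unfolding U'_def by (rule union_budget[OF Some[unfolded f_def]]) (use True in \<open>simp add: U'_def\<close>)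
        from IHr[OF this U' True] obtain T where T: "T + W \<le> 2 * W * nodes L B k (L - length U')"
          "computes prog solve_fn [enc_M, un i, un j, lv, enc_list un V, enc_list un U', un k]
            (enc_bool (solve E i j L V U' k)) T" by blast
        have "N + 2 * W * nodes L B k (L - length U') = 2 * W * nodes L B k (Suc (L - length U'))"
          unfolding N_def by (simp add: nodes_Suc_budget[symmetric] algebra_simps)
        also have "\<dots> \<le> 2 * W * nodes L B k r"
          using lt unfolding r_def by (intro mult_le_mono2 nodes_mono) simp
        finally show ?thesis using A T by (intro exI[of _ T]) linarith
      next
        case False
        then show ?thesis using A N_le by (intro exI[of _ 0]) auto
      qed
      then obtain T where T: "2 * W + A + T \<le> 2 * W * nodes L B k r"
        and sv: "length U' \<le> L \<Longrightarrow>
          computes prog solve_fn [enc_M, un i, un j, lv, enc_list un V, enc_list un U', un k]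
            (enc_bool (solve E i j L V U' k)) T" by blast
      have s: "solve E i j L V U k = ((k \<noteq> 0 \<and> list_ex rec C) \<or> length U' \<le> L \<and> solve E i j L V U' k)"
        by (subst solve.simps) (use Some in \<open>auto simp: f_def cs_def rec_def C_def U'_def\<close>)
      have C': "app_val (enc_list un X) (enc_list un (concat (map (out E V) X))) = enc_list un C"
        by (simp add: C_def)
      have ap: "computes prog app_fn [enc_list un X, enc_list un (concat (map (out E V) X))]
          (enc_list un C) (20 * K)"
        using computes_mono[OF app_computes[of "enc_list un X" "enc_list un (concat (map (out E V) X))", unfolded C']]
          Xok by simp
      define kv where "kv = un k"
      have kv: "kv = Leaf \<longleftrightarrow> k = 0" "snd_val kv = un (k - 1)"
        by (cases k; simp add: kv_def)+
      have "computes prog solve_fn [enc_M, un i, un j, lv, enc_list un V, enc_list un U, un k]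
        (enc_bool (solve E i j L V U k)) (4000 * Z + A + T)"
        unfolding s kv_def[symmetric] using big Z
        by (intro computesI, unfold prog_nth solve_body_def)
           (simp add: Some kv del: not_None_eq
            | rule wpc_computes[OF cnd] wpc_computes[OF f1] wpc_computes[OF os] wpc_computes[OF ap]
                wpc_computes[OF un] wpc_computes[OF lq] wpc_computes[OF any[unfolded One_nat_def]] wpc_computes[OF sv[folded kv_def]]
            | intro conjI impI)+
      moreover have "4000 * Z + A + T + W \<le> 2 * W * nodes L B k r"
        using T Z unfolding W_def by linarith
      ultimately show ?thesis unfolding r_def by blast
    qed
  qed
qed

end

section \<open>From the encoded instance to the total running time\<close>

context adjacency_matrix begin

text \<open>The preparation costs a fourth power because of the ordering. The claim on
  \<open>solve\<close> quantifies over \<open>lv\<close>, since the budget list is characterised by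
  its length only.\<close>

lemma main_computes:
  fixes i j k l T :: nat
  assumes l: "length (bits i) \<le> l" "length (bits j) \<le> l" "length (bits k) \<le> l" "length M \<le> l"
  defines "V \<equiv> elim_order E [0..<length M]"
  defines "d \<equiv> length (max_out E V)"
  defines "k' \<equiv> min k (length M)"
  assumes solve: "\<And>lv. spine lv = k' * d \<Longrightarrow>
      computes prog solve_fn [enc_M, un (min i K), un (min j K), lv, enc_list un V, Leaf, un k'] v T"
  shows "computes prog 0 [Node enc_M (Node (enc_nat i) (Node (enc_nat j) (enc_nat k)))] v
    (2000 * (l + 1) ^ 4 + T)"
proof -
  define x where "x = l + 1"
  define x2 where "x2 = x * x"
  define x4 where "x4 = x2 * x2"
  have Kx: "K \<le> x" using l(4) by (simp add: K x_def)
  have K2x: "K2 \<le> x2" unfolding K2_def x2_def using Kx by (intro mult_le_mono)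
  have K4x: "K4 \<le> x4"
    unfolding K4_def K3_def x4_def using K2x Kx by (metis K2_def mult.assoc mult_le_mono)
  have x1: "1 \<le> x" by (simp add: x_def)
  have "x \<le> x2" using x1 by (simp add: x2_def)
  moreover have "x2 \<le> x4" using x1 by (simp add: x4_def x2_def)
  ultimately have xs: "1 \<le> x4" "x2 \<le> x4" "x \<le> x4" "K \<le> x4" "K2 \<le> x4" "K3 \<le> x4" "K4 \<le> x4"
    using Kx K2x K4x Kpow x1 by linarith+
  have un: "computes prog unary_fn [enc_nat a, c] (un (min a (spine c))) (180 * x4)"
    if "length (bits a) \<le> l" "spine c \<le> x" for a c
    unfolding enc_nat_def
  proof (rule computes_mono[OF unary_computes[of "bits a" c, unfolded of_bits_bits]])
    have "(length (bits a) + 1) * (60 * (spine c + 2)) \<le> x * (60 * (x + 2))"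
      using that by (intro mult_le_mono) (auto simp: x_def)
    also have "\<dots> = 60 * x2 + 120 * x" by (simp add: x2_def algebra_simps)
    finally show "(length (bits a) + 1) * (60 * (spine c + 2)) \<le> 180 * x4" using xs by linarith
  qed
  have ui: "computes prog unary_fn [enc_nat i, Node Leaf enc_M] (un (min i K)) (180 * x4)"
    and uj: "computes prog unary_fn [enc_nat j, Node Leaf enc_M] (un (min j K)) (180 * x4)"
    using un[OF l(1), of "Node Leaf enc_M"] un[OF l(2), of "Node Leaf enc_M"] Kx by (simp_all add: K)
  have uk: "computes prog unary_fn [enc_nat k, enc_M] (un k') (180 * x4)"
    using un[OF l(3), of enc_M] l(4) by (simp add: k'_def x_def)
  have io: "computes prog iota_fn [enc_M, Leaf] (enc_list un [0..<length M]) (20 * K)"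
    using iota_computes[of "enc_list enc_bool" M 0] by (simp add: K)
  have vl: "vlist [0..<length M]" "length [0..<length M] < K" by (auto simp: vlist_def K)
  have od: "computes prog order_fn [enc_M, enc_list un [0..<length M]] (enc_list un V) (400 * K4)"
    unfolding V_def by (rule computes_mono[OF order_computes[OF vl] loop_bound(3)[OF vl(2)]])
  have V: "vlist V" "length V < K"
    using vl distinct_elim_order[of "[0..<length M]" E] by (auto simp: V_def vlist_def intro!: distinct_less_K)
  have mo: "computes prog max_out_fn [enc_M, enc_list un V] (enc_list un (max_out E V)) (150 * K3)"
    using V by (intro max_out_computes')
  have dK: "d < K" using length_max_out[of E V] V unfolding d_def by linarith
  have "(k' + 1) * (20 * (d + 2)) \<le> K * (20 * (K + 1))"
    using dK by (intro mult_le_mono) (auto simp: k'_def K)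
  also have "\<dots> = 20 * K2 + 20 * K" by (simp add: K2_def algebra_simps)
  also have "\<dots> \<le> 40 * x4" using xs by linarith
  finally have re: "computes prog rep_fn [un k', enc_list un (max_out E V)]
      (rep_val k' (enc_list un (max_out E V))) (40 * x4)"
    using computes_mono[OF rep_computes[of k' "enc_list un (max_out E V)"]] by (simp add: d_def)
  note so = solve[of "rep_val k' (enc_list un (max_out E V))", unfolded spine_rep_val spine_enc_list,
      folded d_def, OF refl]
  have "computes prog 0 [Node enc_M (Node (enc_nat i) (Node (enc_nat j) (enc_nat k)))] v
    (2000 * x4 + T)"
    using xs
    by (intro computesI, unfold prog_nth main_body_def)
       (simp | rule wpc_computes[OF ui] | rule wpc_computes[OF uj] | rule wpc_computes[OF uk]
         | rule wpc_computes[OF io] wpc_computes[OF od] wpc_computes[OF mo] wpc_computes[OF re] wpc_computes[OF so])+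
  moreover have "x4 = (l + 1) ^ 4"
    by (simp only: x4_def x2_def x_def power4_eq_xxxx mult.assoc)
  ultimately show ?thesis by simp
qed

end

text \<open>The two extra steps are the variable and the call at the entry point.\<close>

lemma runs_computes:
  assumes "computes prog 0 [x] v T"
  shows "\<exists>t. runs prog x v t \<and> t \<le> T + 2"
proof -
  have "wp prog [x] (Call 0 [Var 0]) (\<lambda>w s. w = v \<and> s \<le> T + 2)"
    by simp (rule wpc_computes[OF assms], simp)
  then show ?thesis unfolding runs_def wp_def by blast
qed

text \<open>Origin of the exponent: \<open>L + 1\<close> is at most \<open>2 ^ (d * m)\<close> and
  \<open>B\<close> is \<open>2 ^ (2 * d * m)\<close>, so depth at most \<open>m\<close> yields
  \<open>2 ^ (3 * d * m\<^sup>2)\<close>. The factor \<open>2 ^ d\<close> for the candidates of each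
  call accounts for the fourth \<open>d * m\<^sup>2\<close>. Here \<open>m \<ge> 1\<close> is
  essential; it also gives \<open>d + d * d \<le> 2 ^ (2 * d) \<le> B\<close>.\<close>

lemma nodes_bound:
  fixes d k k' n :: nat
  assumes k': "k' \<le> k" "k' \<le> n" and d: "d \<le> n"
  defines "m \<equiv> max 1 k"
  defines "B \<equiv> 2 ^ (2 * d * m)" and "L \<equiv> k' * d"
  shows "2 ^ d * nodes L B k' L \<le> (n + 1) ^ 3 * 2 ^ (4 * d * m\<^sup>2)"
    and "d + d * d \<le> B" and "2 ^ L \<le> B"
proof -
  have m: "1 \<le> m" "k' \<le> m" using k' by (auto simp: m_def)
  have mm: "m \<le> m\<^sup>2" using m by (simp add: power2_eq_square)
  have L: "L \<le> d * m" using m by (simp add: L_def)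
  have LB: "L + 1 \<le> 2 ^ (d * m)"
  proof -
    have "L + 1 \<le> 2 ^ L" using Suc_leI[OF less_exp[of L]] by (simp only: Suc_eq_plus1)
    also have "\<dots> \<le> 2 ^ (d * m)" using L by (intro power_increasing) auto
    finally show ?thesis .
  qed
  have "2 * d * m \<ge> L" using L by simp
  then show "2 ^ L \<le> B" unfolding B_def by (intro power_increasing) auto
  have "d + 1 \<le> 2 ^ d" "d \<le> 2 ^ d" using Suc_leI[OF less_exp[of d]] by auto
  then have "d * (d + 1) \<le> 2 ^ d * 2 ^ d" by (intro mult_le_mono)
  also have "\<dots> = 2 ^ (2 * d)" by (simp add: power_add[symmetric])
  also have "\<dots> \<le> B" unfolding B_def using m by (intro power_increasing) auto
  finally show "d + d * d \<le> B" by simp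
  have "(L + 1) * B \<le> 2 ^ (d * m) * 2 ^ (2 * d * m)"
    unfolding B_def using LB by (intro mult_le_mono) auto
  also have "\<dots> = 2 ^ (3 * d * m)" by (simp add: power_add[symmetric])
  finally have "((L + 1) * B) ^ k' \<le> (2 ^ (3 * d * m)) ^ k'" by (rule power_mono) simp
  also have "\<dots> \<le> (2 ^ (3 * d * m)) ^ m" using m by (intro power_increasing) auto
  also have "\<dots> = 2 ^ (3 * d * m\<^sup>2)" by (simp add: power_mult[symmetric] power2_eq_square mult.assoc)
  finally have P: "((L + 1) * B) ^ k' \<le> 2 ^ (3 * d * m\<^sup>2)" .
  have "2 ^ d * ((L + 1) * B) ^ k' \<le> 2 ^ (d * m\<^sup>2) * 2 ^ (3 * d * m\<^sup>2)"
    using m mm by (intro mult_le_mono P power_increasing) auto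
  also have "\<dots> = 2 ^ (4 * d * m\<^sup>2)" by (simp add: power_add[symmetric])
  finally have Q: "2 ^ d * ((L + 1) * B) ^ k' \<le> 2 ^ (4 * d * m\<^sup>2)" .
  have "L \<le> n * n" unfolding L_def using k' d by (intro mult_le_mono)
  then have "L + 1 \<le> (n + 1) * (n + 1)" by simp
  then have R: "(L + 1) * (k' + 1) \<le> (n + 1) ^ 3"
    using k' unfolding power3_eq_cube by (intro mult_le_mono) auto
  have "2 ^ d * nodes L B k' L = (L + 1) * (k' + 1) * (2 ^ d * ((L + 1) * B) ^ k')"
    unfolding nodes_def by (simp only: mult_ac)
  also have "\<dots> \<le> (n + 1) ^ 3 * 2 ^ (4 * d * m\<^sup>2)" by (intro mult_le_mono R Q)
  finally show "2 ^ d * nodes L B k' L \<le> (n + 1) ^ 3 * 2 ^ (4 * d * m\<^sup>2)" .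
qed

lemma length_le_size_enc_list: "length xs \<le> size (enc_list f xs)"
  by (induction xs) auto

theorem theorem7:
  shows "\<exists>(P :: program) (c :: nat) (p :: nat poly).
    \<forall>(G :: nat pair_pre_digraph) (i :: nat) (j :: nat) (k :: nat).
      pair_graph G \<and> i \<le> j \<longrightarrow>
      (\<exists>v t. runs P (enc_instance G i j k) v t \<and>
        (v \<noteq> Leaf \<longleftrightarrow> bfvd i j k (with_proj G)) \<and>
        t \<le> 2 ^ (c * degeneracy (with_proj G) * (max 1 k)\<^sup>2) * poly p (size (enc_instance G i j k)))"
\<comment> \<open>The constant 4 is that of \<open>nodes_bound\<close>. The degree 7 is 4 for the
  work per call plus 3 from the polynomial factor in the number of calls; half of 20000 is for the
  search, the other half exceeds the preparation.\<close>
proof (rule exI[of _ prog], rule exI[of _ 4], rule exI[of _ "smult 20000 ([:1, 1:] ^ 7)"], intro allI impI)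
  fix G :: "nat pair_pre_digraph" and i j k :: nat
  assume "pair_graph G \<and> i \<le> j"
  then have G: "pair_graph G" by simp
  interpret pair_graph G by fact
  define M where "M = adj_matrix G"
  define n where "n = length M"
  note adj = adj_matrix_props[OF pair_finite_verts, folded M_def]
  interpret adjacency_matrix M "n + 1"
    by unfold_locales (use adj(2) in \<open>auto simp: n_def\<close>)
  let ?\<delta> = "degeneracy (with_proj G)" and ?s = "size (enc_instance G i j k)"
  define V where "V = elim_order E [0..<n]"
  define d where "d = length (max_out E V)"
  define k' where "k' = min k n"
  define L where "L = k' * d"
  define m where "m = max 1 k"
  define B :: nat where "B = 2 ^ (2 * d * m)"
  define r where "r = solve E (min i (n + 1)) (min j (n + 1)) L V [] k'"
  define T where "T = 2 * (5000 * (K4 * 2 ^ d)) * nodes L B k' L"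
  have E: "simple_on E {..<n}"
    using adj(1,3) pair_no_loops pair_sym_arcs
    by (fastforce simp: simple_on_def n_def symmetric_def dest: symD)
  have V: "set V = {..<n}" "distinct V" by (auto simp: V_def distinct_elim_order)
  have d: "d \<le> n"
    using length_max_out[of E V] distinct_card[OF V(2)] V(1) by (simp add: d_def)
  \<comment> \<open>The only place where the degeneracy enters: the running time is first bounded in
    terms of the computed \<open>d\<close>.\<close>
  have d\<delta>: "d \<le> ?\<delta>"
    unfolding d_def V_def using degeneracy_adj_matrix[OF G]
    by (intro length_max_out_elim_order) (auto simp: M_def n_def atLeast0LessThan)
  have k': "k' \<le> k" "k' \<le> n" by (simp_all add: k'_def)
  note nb = nodes_bound[OF k' d, folded m_def, folded B_def L_def]
  have "bfvd i j k (with_proj G) \<longleftrightarrow> (\<exists>S\<subseteq>{..<n}. card S \<le> k \<and> \<not> biclique E i j ({..<n} - S))"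
    using bfvd_adj_matrix[OF G] by (simp add: M_def n_def)
  \<comment> \<open>Passage to the capped parameters on which the program actually works.\<close>
  also have "\<dots> \<longleftrightarrow> (\<exists>S\<subseteq>{..<n}. card S \<le> k' \<and> \<not> biclique E (min i (n + 1)) (min j (n + 1)) ({..<n} - S))"
  proof -
    have "card S \<le> k \<longleftrightarrow> card S \<le> k'" if "S \<subseteq> {..<n}" for S
      using card_mono[OF _ that] by (auto simp: k'_def)
    moreover have "biclique E (min i (n + 1)) (min j (n + 1)) ({..<n} - S) \<longleftrightarrow> biclique E i j ({..<n} - S)" for S
      using card_mono[of "{..<n}" "{..<n} - S"] by (intro biclique_cap) auto
    ultimately show ?thesis by blast
  qed
  also have "\<dots> \<longleftrightarrow> r"
    unfolding r_def L_def V_def by (rule solve_correct[OF E, symmetric]) (simp add: d_def V_def)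
  finally have correct: "enc_bool r \<noteq> Leaf \<longleftrightarrow> bfvd i j k (with_proj G)" by simp
  have sv: "computes prog solve_fn
      [enc_M, un (min i (n + 1)), un (min j (n + 1)), lv, enc_list un V, Leaf, un k'] (enc_bool r) T"
    if "spine lv = k' * d" for lv
  proof -
    have "vlist V" unfolding vlist_def using V(1) by (simp add: n_def)
    moreover have "spine lv = L" using that by (simp add: L_def)
    ultimately have "\<exists>t. t + 5000 * (K4 * 2 ^ d) \<le> 2 * (5000 * (K4 * 2 ^ d)) * nodes L B k' (L - length []) \<and>
      computes prog solve_fn [enc_M, un (min i (n + 1)), un (min j (n + 1)), lv, enc_list un V, enc_list un [], un k']
        (enc_bool (solve E (min i (n + 1)) (min j (n + 1)) L V [] k')) t"
      using V(2) solve_computes[OF _ _ nb(2,3), of "min i (n + 1)" "min j (n + 1)" lv V "[]" k']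
      by (simp add: d_def)
    then obtain t where "t + 5000 * (K4 * 2 ^ d) \<le> T" "computes prog solve_fn
      [enc_M, un (min i (n + 1)), un (min j (n + 1)), lv, enc_list un V, Leaf, un k'] (enc_bool r) t"
      unfolding T_def r_def by auto
    then show ?thesis by (intro computes_mono[of _ _ _ _ t T]) auto
  qed
  have size: "length (bits i) \<le> ?s" "length (bits j) \<le> ?s" "length (bits k) \<le> ?s" "length M \<le> ?s"
    using length_le_size_enc_list[of "bits i" enc_bool] length_le_size_enc_list[of "bits j" enc_bool]
      length_le_size_enc_list[of "bits k" enc_bool] length_le_size_enc_list[of M "enc_list enc_bool"]
    by (simp_all add: enc_instance_def enc_nat_def M_def)
  have "computes prog 0 [enc_instance G i j k] (enc_bool r) (2000 * (?s + 1) ^ 4 + T)"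
    unfolding enc_instance_def M_def[symmetric]
    using main_computes[OF size, of "enc_bool r" T] sv
    unfolding n_def[symmetric] V_def[symmetric] d_def[symmetric] k'_def[symmetric]
    by (simp add: enc_instance_def M_def)
  from runs_computes[OF this] obtain t where t: "runs prog (enc_instance G i j k) (enc_bool r) t"
    "t \<le> 2000 * (?s + 1) ^ 4 + T + 2" by blast
  have "t \<le> 2 ^ (4 * ?\<delta> * m\<^sup>2) * (20000 * (?s + 1) ^ 7)"
  proof -
    let ?x = "?s + 1" and ?e = "(2::nat) ^ (4 * ?\<delta> * m\<^sup>2)"
    have nx: "n + 1 \<le> ?x" using size(4) by (simp add: n_def)
    have K4: "K4 = (n + 1) ^ 4" by (simp only: K4_def K3_def K2_def power4_eq_xxxx)
    have "T = 10000 * (K4 * (2 ^ d * nodes L B k' L))" unfolding T_def by simp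
    also have "\<dots> \<le> 10000 * ((n + 1) ^ 4 * ((n + 1) ^ 3 * 2 ^ (4 * d * m\<^sup>2)))"
      unfolding K4 by (intro mult_le_mono2 nb(1))
    also have "\<dots> = 10000 * ((n + 1) ^ 7 * 2 ^ (4 * d * m\<^sup>2))"
      by (simp only: mult.assoc[symmetric] power_add[symmetric]) simp
    also have "\<dots> \<le> 10000 * (?x ^ 7 * ?e)"
      using d\<delta> nx by (intro mult_le_mono power_mono power_increasing) auto
    finally have T: "T \<le> 10000 * (?x ^ 7 * ?e)" .
    have "?x ^ 4 \<le> ?x ^ 7" by (intro power_increasing) auto
    also have "?x ^ 7 * 1 \<le> ?x ^ 7 * ?e" by (intro mult_le_mono2) simp
    finally have x4: "?x ^ 4 \<le> ?x ^ 7 * ?e" by simp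
    have "1 \<le> ?x ^ 4" by simp
    then have "t \<le> 20000 * (?x ^ 7 * ?e)" using t(2) T x4 by linarith
    then show ?thesis by (simp only: mult_ac)
  qed
  also have "20000 * (?s + 1) ^ 7 = poly (smult 20000 ([:1, 1:] ^ 7)) ?s"
    by (simp add: poly_power)
  finally show "\<exists>v t. runs prog (enc_instance G i j k) v t \<and> (v \<noteq> Leaf \<longleftrightarrow> bfvd i j k (with_proj G)) \<and>
      t \<le> 2 ^ (4 * ?\<delta> * (max 1 k)\<^sup>2) * poly (smult 20000 ([:1, 1:] ^ 7)) ?s"
    using t(1) correct unfolding m_def by blast
qed

end
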